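(* Let $G$ be a locally compact group (satisfying the second axiom of countability) and let $(\pi, X, \mu, \nu, U)$ be a $5$-tuple where (1) $\pi$ is an action of $G$ on $X$; (2) $(X,\mu)$ is a measure space with $\mu$ a $\pi$-quasi-invariant measure; (3) $\nu: X\to \mathbb{N}\cup\{\infty\}$ is a $\pi$-invariant measurable function; (4) $U$ is a $(G,X,\mathcal{H})$-cocycle relative to $\mu$, where $\mathcal{H}=\int_X^{\oplus}\mathcal{H}_x\,d\mu(x)$ is the direct integral Hilbert space associated to $(X,\mu,\nu)$. Then the map $\phi=\phi_{(\pi,X,\mu,\nu,U)}: G\to \mathcal{B}(\mathcal{H})$ defined by $$(\phi(g)f)(x)=\sqrt{\frac{d\mu(\pi(g^{-1})x)}{d\mu(x)}}\;U(g,\pi(g^{-1})x)\,f(\pi(g^{-1})x)$$ is a representation of $G$ on $\mathcal{H}$.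
   Context: $\mathcal{B}(\mathcal{H})$ is the set of bounded linear operators on a Hilbert space $\mathcal{H}$, viewed as a Borel space with the smallest $\sigma$-algebra making all maps $A\mapsto\langle Af,h\rangle$, $f,h\in\mathcal{H}$, measurable. A (not necessarily unitary) representation of $G$ on $\mathcal{H}$ is a group homomorphism $\phi:G\to\mathcal{B}(\mathcal{H})$ (so $\phi(gh)=\phi(g)\phi(h)$) that is continuous; continuity is understood to follow from measurability of all the functions $g\mapsto\langle\phi(g)f,h\rangle$, $f,h\in\mathcal{H}$. Direct integral. Let $(X,\mu)$ be a measure space, i.e. a set with a $\sigma$-algebra of subsets and a non-negative completely additive set function $\mu$ on it, and let $\nu:X\to\mathbb{N}\cup\{\infty\}$ be measurable; put $X_m=\{x:\nu(x)=m\}$. For each $m\in\mathbb{N}\cup\{\infty\}$ fix a separable Hilbert space $\mathcal{H}_m$ of dimension $m$, and put $\mathcal{H}_x=\mathcal{H}_m$ if $\nu(x)=m$. The direct integral $\mathcal{H}=\int_X^{\oplus}\mathcal{H}_x\,d\mu(x)$ associated to $(X,\mu,\nu)$ is the Hilbert space of measurable vector functions $f$ with $f(x)\in\mathcal{H}_x$ for almost all $x$ and $\int_X\|f(x)\|^2d\mu<\infty$, with $\langle f,g\rangle=\int_X\langle f(x),g(x)\rangle d\mu(x)$; $f$ is measurable if for each $m$ and each $h\in\mathcal{H}_m$ the function $x\mapsto\langle f(x),h\rangle$ is measurable on $X_m$. An operator $T\in\mathcal{B}(\mathcal{H})$ is decomposable if there is a function $x\mapsto T(x)\in\mathcal{B}(\mathcal{H}_x)$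 such that for each $f\in\mathcal{H}$, $(Tf)(x)=T(x)f(x)$ for almost every $x$. Action. An action of $G$ on $X$ is a map $\pi:G\times X\to X$ such that for each $g\in G$, $\pi(g)$ is a continuous function, $\pi(gh)=\pi(g)\pi(h)$ for all $g,h\in G$, and $\pi(1)$ is the identity. $\mu$ is $\pi$-quasi-invariant if for all $g\in G$: $\mu(E)=0$ if and only if $\mu(\pi(g)E)=0$. $\frac{d\mu(\pi(g)x)}{d\mu(x)}$ denotes the Radon–Nikodym derivative with respect to $\mu$ of the measure $E\mapsto\mu(\pi(g)E)$. $\nu$ is $\pi$-invariant if $\nu(x)=\nu(\pi(g)x)$ for all $g\in G$ and almost every $x\in X$. Cocycle. With $\mu$ $\pi$-quasi-invariant and $\nu$ $\pi$-invariant, a $(G,X,\mathcal{H})$-cocycle relative to $\mu$ is a function $U$ on $G\times X$, with $U(g,x)$ a bounded operator on $\mathcal{H}_x$, such that: (i) $U$ is a Borel map; (ii) for each $g\in G$, $U(g,\cdot)$ is a decomposable bounded operator on $\mathcal{H}$ with decomposition function $x\mapsto U(g,x)$; (iii) $U(1,x)$ is the identity for almost all $x\in X$; (iv) $U(g_1g_2,x)=U(g_1,\pi(g_2)x)\,U(g_2,x)$ for almost all $x\in X$.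
   Formalization: Two assumptions are added: μ is σ-finite (otherwise the Radon–Nikodym derivative may not exist) and the action map (g,x) ↦ π(g)x is jointly measurable (otherwise the matrix coefficients of φ may fail to be measurable). Continuity of φ is stated as measurability of its matrix coefficients. *)

theory Defs
  imports "HOL-Analysis.Analysis"
begin

text \<open>
  Complex inner products, linear in the first argument. The real inner product, the norm and the
  topology inherited from \<^class>\<open>real_inner\<close> are those of the complex inner product because its
  real part is the real inner product.
\<close>

class complex_inner = real_inner +
  fixes scaleC :: "complex \<Rightarrow> 'a \<Rightarrow> 'a"
    and cinner :: "'a \<Rightarrow> 'a \<Rightarrow> complex"
  assumes scaleC_add_right: "scaleC c (x + y) = scaleC c x + scaleC c y"
    and scaleC_add_left: "scaleC (c + d) x = scaleC c x + scaleC d x"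
    and scaleC_scaleC: "scaleC c (scaleC d x) = scaleC (c * d) x"
    and scaleC_of_real: "scaleC (complex_of_real r) x = scaleR r x"
    and cinner_commute: "cinner x y = cnj (cinner y x)"
    and cinner_add_left: "cinner (x + y) z = cinner x z + cinner y z"
    and cinner_scaleC_left: "cinner (scaleC c x) y = c * cinner x y"
    and Re_cinner: "Re (cinner x y) = inner x y"

global_interpretation complex_vector:
  vector_space "scaleC :: complex \<Rightarrow> 'a \<Rightarrow> 'a::complex_inner"
  defines csubspace = complex_vector.subspace
    and cspan = complex_vector.span
proof
  show "scaleC 1 x = x" for x :: 'a
    using scaleC_of_real[of 1 x] by simp
qed (simp_all add: scaleC_add_right scaleC_add_left scaleC_scaleC)

definition orthonormal_basis :: "'h::complex_inner set \<Rightarrow> 'h set \<Rightarrow> bool" where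
  "orthonormal_basis B V \<longleftrightarrow>
     (\<forall>b\<in>B. norm b = 1) \<and> (\<forall>b\<in>B. \<forall>c\<in>B. b \<noteq> c \<longrightarrow> cinner b c = 0) \<and>
     closure (cspan B) = V"

text \<open>
  The Hilbert spaces \<open>H m\<close> are complete subspaces of one ambient inner product space. Any family
  of Hilbert spaces can be presented in this way, e.g. inside its orthogonal sum.
\<close>

definition separable_hilbert_space :: "'h::complex_inner set \<Rightarrow> enat \<Rightarrow> bool" where
  "separable_hilbert_space V m \<longleftrightarrow>
     csubspace V \<and> complete V \<and>
     (\<exists>D. countable D \<and> D \<subseteq> V \<and> V \<subseteq> closure D) \<and>
     (\<exists>B. orthonormal_basis B V \<and> (if finite B then enat (card B) else \<infinity>) = m)"

record 'v inner_space =
  vcarrier :: "'v set"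
  vadd :: "'v \<Rightarrow> 'v \<Rightarrow> 'v"
  vscale :: "complex \<Rightarrow> 'v \<Rightarrow> 'v"
  vinner :: "'v \<Rightarrow> 'v \<Rightarrow> complex"

definition vnorm :: "'v inner_space \<Rightarrow> 'v \<Rightarrow> real" where
  "vnorm S v = sqrt (Re (vinner S v v))"

definition subspace_of_type :: "'h::complex_inner set \<Rightarrow> 'h inner_space" where
  "subspace_of_type V = \<lparr>vcarrier = V, vadd = (+), vscale = scaleC, vinner = cinner\<rparr>"

text \<open>The operators are only determined on the carrier.\<close>

definition bounded_operators :: "'v inner_space \<Rightarrow> ('v \<Rightarrow> 'v) set" where
  "bounded_operators S =
     {T. T \<in> vcarrier S \<rightarrow> vcarrier S \<and>
         (\<forall>u\<in>vcarrier S. \<forall>v\<in>vcarrier S. T (vadd S u v) = vadd S (T u) (T v)) \<and>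
         (\<forall>c. \<forall>v\<in>vcarrier S. T (vscale S c v) = vscale S c (T v)) \<and>
         (\<exists>K. \<forall>v\<in>vcarrier S. vnorm S (T v) \<le> K * vnorm S v)}"

text \<open>
  Groups are written additively, as in \<^class>\<open>group_add\<close>, which does not assume commutativity:
  \<open>g + h\<close>, \<open>0\<close> and \<open>- g\<close> are the product, the unit and the inverse.
  Continuity of a representation is imposed in the form of measurability of all
  matrix coefficients.
\<close>

definition group_representation ::
  "'v inner_space \<Rightarrow> ('g::topological_group_add \<Rightarrow> 'v \<Rightarrow> 'v) \<Rightarrow> bool" where
  "group_representation S \<phi> \<longleftrightarrow>
     (\<forall>g. \<phi> g \<in> bounded_operators S) \<and>
     (\<forall>g h. \<forall>v\<in>vcarrier S. \<phi> (g + h) v = \<phi> g (\<phi> h v)) \<and>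
     (\<forall>v\<in>vcarrier S. \<phi> 0 v = v) \<and>
     (\<forall>u\<in>vcarrier S. \<forall>v\<in>vcarrier S. (\<lambda>g. vinner S (\<phi> g u) v) \<in> borel_measurable borel)"

definition level_set :: "'x measure \<Rightarrow> ('x \<Rightarrow> enat) \<Rightarrow> enat \<Rightarrow> 'x set" where
  "level_set M \<nu> m = {x \<in> space M. \<nu> x = m}"

text \<open>
  Since \<open>f x \<in> H (\<nu> x)\<close> is only required almost everywhere, measurability of a vector function
  has to be insensitive to null sets; hence the completion of the measure.
\<close>

definition square_integrable_fields ::
  "'x measure \<Rightarrow> ('x \<Rightarrow> enat) \<Rightarrow> (enat \<Rightarrow> 'h::complex_inner set) \<Rightarrow> ('x \<Rightarrow> 'h) set" where
  "square_integrable_fields M \<nu> H =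
     {f. (AE x in M. f x \<in> H (\<nu> x)) \<and>
         (\<forall>m. \<forall>h\<in>H m. (\<lambda>x. cinner (f x) h)
            \<in> borel_measurable (restrict_space (completion M) (level_set M \<nu> m))) \<and>
         (\<integral>\<^sup>+ x. ennreal ((norm (f x))\<^sup>2) \<partial>completion M) < \<infinity>}"

definition ae_equal ::
  "'x measure \<Rightarrow> ('x \<Rightarrow> enat) \<Rightarrow> (enat \<Rightarrow> 'h::complex_inner set) \<Rightarrow> (('x \<Rightarrow> 'h) \<times> ('x \<Rightarrow> 'h)) set" where
  "ae_equal M \<nu> H =
     {(f, g). f \<in> square_integrable_fields M \<nu> H \<and> g \<in> square_integrable_fields M \<nu> H \<and>
              (AE x in M. f x = g x)}"

text \<open>The class is empty if \<open>f\<close> is not a square integrable field.\<close>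

definition ae_class ::
  "'x measure \<Rightarrow> ('x \<Rightarrow> enat) \<Rightarrow> (enat \<Rightarrow> 'h::complex_inner set) \<Rightarrow> ('x \<Rightarrow> 'h) \<Rightarrow> ('x \<Rightarrow> 'h) set" where
  "ae_class M \<nu> H f = ae_equal M \<nu> H `` {f}"

definition direct_integral ::
  "'x measure \<Rightarrow> ('x \<Rightarrow> enat) \<Rightarrow> (enat \<Rightarrow> 'h::complex_inner set) \<Rightarrow> ('x \<Rightarrow> 'h) set inner_space" where
  "direct_integral M \<nu> H =
     \<lparr>vcarrier = square_integrable_fields M \<nu> H // ae_equal M \<nu> H,
      vadd = (\<lambda>F G. \<Union>f\<in>F. \<Union>g\<in>G. ae_class M \<nu> H (\<lambda>x. f x + g x)),
      vscale = (\<lambda>c F. \<Union>f\<in>F. ae_class M \<nu> H (\<lambda>x. scaleC c (f x))),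
      vinner = (\<lambda>F G. the_elem (\<Union>f\<in>F. \<Union>g\<in>G.
                  {LINT x|completion M. cinner (f x) (g x)}))\<rparr>"

definition has_decomposition ::
  "'x measure \<Rightarrow> ('x \<Rightarrow> enat) \<Rightarrow> (enat \<Rightarrow> 'h::complex_inner set) \<Rightarrow>
   (('x \<Rightarrow> 'h) set \<Rightarrow> ('x \<Rightarrow> 'h) set) \<Rightarrow> ('x \<Rightarrow> 'h \<Rightarrow> 'h) \<Rightarrow> bool" where
  "has_decomposition M \<nu> H T t \<longleftrightarrow>
     (\<forall>x\<in>space M. t x \<in> bounded_operators (subspace_of_type (H (\<nu> x)))) \<and>
     (\<forall>F\<in>vcarrier (direct_integral M \<nu> H). \<forall>f\<in>F. \<forall>k\<in>T F. AE x in M. k x = t x (f x))"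

definition group_action :: "'x topology \<Rightarrow> ('g::group_add \<Rightarrow> 'x \<Rightarrow> 'x) \<Rightarrow> bool" where
  "group_action X \<pi> \<longleftrightarrow>
     (\<forall>g. continuous_map X X (\<pi> g)) \<and>
     (\<forall>g h. \<forall>x\<in>topspace X. \<pi> (g + h) x = \<pi> g (\<pi> h x)) \<and>
     (\<forall>x\<in>topspace X. \<pi> 0 x = x)"

definition quasi_invariant :: "('g \<Rightarrow> 'x \<Rightarrow> 'x) \<Rightarrow> 'x measure \<Rightarrow> bool" where
  "quasi_invariant \<pi> M \<longleftrightarrow>
     (\<forall>g. \<forall>E\<in>sets M. emeasure M E = 0 \<longleftrightarrow> emeasure M (\<pi> g ` E) = 0)"

definition invariant_ae :: "('g \<Rightarrow> 'x \<Rightarrow> 'x) \<Rightarrow> 'x measure \<Rightarrow> ('x \<Rightarrow> enat) \<Rightarrow> bool" where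
  "invariant_ae \<pi> M \<nu> \<longleftrightarrow> (\<forall>g. AE x in M. \<nu> x = \<nu> (\<pi> g x))"

definition translated_measure :: "('g \<Rightarrow> 'x \<Rightarrow> 'x) \<Rightarrow> 'x measure \<Rightarrow> 'g \<Rightarrow> 'x measure" where
  "translated_measure \<pi> M g = measure_of (space M) (sets M) (\<lambda>E. emeasure M (\<pi> g ` E))"

definition translation_derivative :: "('g \<Rightarrow> 'x \<Rightarrow> 'x) \<Rightarrow> 'x measure \<Rightarrow> 'g \<Rightarrow> 'x \<Rightarrow> real" where
  "translation_derivative \<pi> M g x = enn2real (RN_deriv M (translated_measure \<pi> M g) x)"

definition cocycle ::
  "('g::topological_group_add \<Rightarrow> 'x \<Rightarrow> 'x) \<Rightarrow> 'x measure \<Rightarrow> ('x \<Rightarrow> enat) \<Rightarrow>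
   (enat \<Rightarrow> 'h::complex_inner set) \<Rightarrow> ('g \<Rightarrow> 'x \<Rightarrow> 'h \<Rightarrow> 'h) \<Rightarrow> bool" where
  "cocycle \<pi> M \<nu> H U \<longleftrightarrow>
     (\<forall>g. \<forall>x\<in>space M. U g x \<in> bounded_operators (subspace_of_type (H (\<nu> x)))) \<and>
     (\<forall>m. \<forall>u\<in>H m. \<forall>v\<in>H m. (\<lambda>(g, x). cinner (U g x u) v)
        \<in> borel_measurable (borel \<Otimes>\<^sub>M restrict_space M (level_set M \<nu> m))) \<and>
     (\<forall>g. \<exists>T\<in>bounded_operators (direct_integral M \<nu> H). has_decomposition M \<nu> H T (U g)) \<and>
     (AE x in M. \<forall>v\<in>H (\<nu> x). U 0 x v = v) \<and>
     (\<forall>g h. AE x in M. \<forall>v\<in>H (\<nu> x). U (g + h) x v = U g (\<pi> h x) (U h x v))"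

definition cocycle_representation ::
  "('g::topological_group_add \<Rightarrow> 'x \<Rightarrow> 'x) \<Rightarrow> 'x measure \<Rightarrow> ('x \<Rightarrow> enat) \<Rightarrow>
   (enat \<Rightarrow> 'h::complex_inner set) \<Rightarrow> ('g \<Rightarrow> 'x \<Rightarrow> 'h \<Rightarrow> 'h) \<Rightarrow>
   'g \<Rightarrow> ('x \<Rightarrow> 'h) set \<Rightarrow> ('x \<Rightarrow> 'h) set" where
  "cocycle_representation \<pi> M \<nu> H U g F =
     (\<Union>f\<in>F. ae_class M \<nu> H
        (\<lambda>x. sqrt (translation_derivative \<pi> M (- g) x) *\<^sub>R
              U g (\<pi> (- g) x) (f (\<pi> (- g) x))))"

end

theory Submission
  imports Defs
begin

text \<open>
  Algebraically the formula for \<open>\<phi> g\<close> is a weighted composition, and everything except measurability of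
  the matrix coefficients is a change of variables. Since \<open>U g\<close> is the decomposition of a bounded
  operator, \<open>x \<mapsto> U g x (f x)\<close> is again a square integrable field, and moving it along \<open>\<pi> g\<close> with the
  square root of the derivative preserves the norm (\<open>L2_translate\<close>); this gives boundedness. The
  cocycle identity together with the chain rule for Radon-Nikodym derivatives
  (\<open>derivative_chain_rule\<close>) gives multiplicativity (\<open>act_field_compose\<close>).

  The difficulty is to see that \<open>g \<mapsto> \<langle>\<phi> g f, k\<rangle>\<close> is Borel. The derivative is chosen separately for
  every \<open>g\<close>, so nothing says that it is measurable in the pair \<open>(g, x)\<close>, and the sigma-algebra of
  \<open>M\<close> need not be countably generated, which rules out an explicit construction as a limit over
  partitions. What is shown instead is that translation is automatically continuous: for a finite
  measure \<open>N\<close> equivalent to \<open>M\<close>, the translates of \<open>N\<close> converge to \<open>N\<close> in total variation as the group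
  element tends to 0 (\<open>translates_TV_continuous\<close>). Otherwise there would be a sequence of
  group elements tending to 0 and a sequence of sets witnessing the failure. All translates of these countably
  many sets lie in one countably generated sigma-algebra, because the action is jointly measurable
  (\<open>sections_countably_generated\<close>). On that sigma-algebra the translates of \<open>N\<close> form a separable
  set in total variation (\<open>dominated_measures_separable\<close>), so the group is covered by countably many
  Borel sets on each of which the translates differ little from each other. By the
  Baire category theorem one of them has differences filling a neighbourhood of 0
  (\<open>Pettis_countable_cover\<close>), contradicting the choice of the sequences.

  Continuity of \<open>g \<mapsto> d(\<pi> g N)/dN\<close> in \<open>L\<^sup>1\<close> makes it a fast limit of functions that take
  countably many values in \<open>g\<close>, whence a jointly measurable version of the derivative
  (\<open>jointly_measurable_density\<close>). The remaining factor \<open>\<langle>U g y (f y), k x\<rangle>\<close> is jointly measurable after \<open>f\<close> and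
  \<open>k\<close> have been modified on null sets, since a vector in a separable fibre can be approximated by
  countably many fixed ones (\<open>borel_measurable_substitute\<close>). Fubini's theorem then finishes the proof
  (\<open>coefficient_measurable\<close>).
\<close>

section \<open>Baire category in topological groups\<close>

definition meager :: "'a::topological_space set \<Rightarrow> bool" where
  "meager S \<longleftrightarrow> (\<exists>\<G>. countable \<G> \<and> (\<forall>T\<in>\<G>. closed T \<and> interior T = {}) \<and> S \<subseteq> \<Union>\<G>)"

lemma meager_subset: "meager T \<Longrightarrow> S \<subseteq> T \<Longrightarrow> meager S"
  unfolding meager_def by (meson subset_trans)

lemma meager_UN:
  assumes "\<And>i::nat. meager (S i)"
  shows "meager (\<Union>i. S i)"
proof -
  obtain \<G> where \<G>: "\<And>i. countable (\<G> i)" "\<And>i. \<forall>T\<in>\<G> i. closed T \<and> interior T = {}" "\<And>i. S i \<subseteq> \<Union>(\<G> i)"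
    using assms unfolding meager_def by metis
  then show ?thesis
    unfolding meager_def
  proof (intro exI conjI)
    show "countable (\<Union>i. \<G> i)" using \<G>(1) by simp
    show "\<forall>T\<in>(\<Union>i. \<G> i). closed T \<and> interior T = {}"
      unfolding ball_UN using \<G>(2) by simp
    show "(\<Union>i. S i) \<subseteq> \<Union>(\<Union>i. \<G> i)"
    proof
      fix x assume "x \<in> (\<Union>i. S i)"
      then obtain i where "x \<in> S i" by (elim UN_E)
      then have "x \<in> \<Union>(\<G> i)" using \<G>(3) by (rule rev_subsetD)
      then show "x \<in> \<Union>(\<Union>i. \<G> i)" by auto
    qed
  qed
qed

lemma meager_Un: "meager S \<Longrightarrow> meager T \<Longrightarrow> meager (S \<union> T)"
  unfolding meager_def by (elim exE, rename_tac F G, rule_tac x = "F \<union> G" in exI) auto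

lemma meager_nowhere_dense: "closed T \<Longrightarrow> interior T = {} \<Longrightarrow> meager T"
  unfolding meager_def by (intro exI[of _ "{T}"]) auto

lemma meager_empty: "meager {}"
  by (simp add: meager_nowhere_dense)

lemma interior_meager:
  fixes S :: "'a::t2_space set"
  assumes lc: "locally compact (UNIV :: 'a set)" and "meager S"
  shows "interior S = {}"
proof -
  have "locally_compact_space (euclidean :: 'a topology)"
    unfolding locally_compact_space_def
  proof
    fix x :: 'a
    obtain U V where "openin (top_of_set UNIV) U" "compact V" "x \<in> U" "U \<subseteq> V"
      using lc unfolding locally_def by (metis UNIV_I openin_subtopology_self)
    then show "\<exists>U K. openin euclidean U \<and> compactin euclidean K \<and> x \<in> U \<and> U \<subseteq> K"
      by auto
  qed
  moreover have "Hausdorff_space (euclidean :: 'a topology)"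
    unfolding Hausdorff_space_def by (metis disjnt_def open_openin separation_t2)
  ultimately have lcr: "locally_compact_space (euclidean :: 'a topology) \<and> regular_space (euclidean :: 'a topology)"
    using locally_compact_Hausdorff_imp_regular_space by blast
  obtain \<G> where \<G>: "countable \<G>" "\<forall>T\<in>\<G>. closed T \<and> interior T = {}" "S \<subseteq> \<Union>\<G>"
    using \<open>meager S\<close> unfolding meager_def by blast
  have "euclidean interior_of \<Union>\<G> = {}"
    using lcr \<G> by (intro Baire_category_alt) auto
  then show ?thesis
    using interior_mono[OF \<G>(3)] by simp
qed

text \<open>
  The sets that differ from an open set by a meager one form a sigma-algebra: for complements, the
  boundary of an open set is closed with empty interior.
\<close>

lemma borel_set_Baire_property:
  fixes B :: "'a::topological_space set"
  assumes "B \<in> sets borel"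
  shows "\<exists>V. open V \<and> meager (B - V) \<and> meager (V - B)"
proof -
  have "B \<in> sigma_sets UNIV {S. open S}"
    using assms by (simp add: borel_def)
  then show ?thesis
  proof induction
    case (Basic a)
    then show ?case using meager_empty by (intro exI[of _ a]) auto
  next
    case Empty
    show ?case by (intro exI[of _ "{}"]) (simp add: meager_empty)
  next
    case (Compl a)
    then obtain V where V: "open V" "meager (a - V)" "meager (V - a)" by blast
    have "interior (closure V - V) = {}"
    proof (rule ccontr)
      assume "interior (closure V - V) \<noteq> {}"
      then obtain x where x: "x \<in> interior (closure V - V)" by blast
      then have "x \<in> closure V" using interior_subset by blast
      then have "interior (closure V - V) \<inter> V \<noteq> {}"
        using x open_interior[of "closure V - V"] unfolding closure_iff_nhds_not_empty by fast
      then show False using interior_subset by blast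
    qed
    then have "meager (closure V - V)"
      using V(1) by (intro meager_nowhere_dense) (auto intro: closed_Diff)
    then have "meager ((closure V - V) \<union> (V - a))" "meager (a - V)"
      using V meager_Un by blast+
    moreover have "(UNIV - a) - (- closure V) \<subseteq> (closure V - V) \<union> (V - a)"
      "- closure V - (UNIV - a) \<subseteq> a - V"
      using closure_subset[of V] by auto
    ultimately have "meager ((UNIV - a) - (- closure V)) \<and> meager (- closure V - (UNIV - a))"
      using meager_subset by blast
    then show ?case
      by (intro exI[of _ "- closure V"] conjI open_Compl closed_closure) simp_all
  next
    case (Union a)
    then obtain V where V: "\<And>i. open (V i)" "\<And>i. meager (a i - V i)" "\<And>i. meager (V i - a i)"
      by metis
    have "meager (\<Union>i. a i - V i)" "meager (\<Union>i. V i - a i)"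
      using V by (auto intro!: meager_UN)
    moreover have "(\<Union>i. a i) - (\<Union>i. V i) \<subseteq> (\<Union>i. a i - V i)"
      "(\<Union>i. V i) - (\<Union>i. a i) \<subseteq> (\<Union>i. V i - a i)"
      by auto
    ultimately have "meager ((\<Union>i. a i) - (\<Union>i. V i)) \<and> meager ((\<Union>i. V i) - (\<Union>i. a i))"
      using meager_subset by blast
    then show ?case
      using V(1) by (intro exI[of _ "\<Union>i. V i"] conjI open_UN) simp_all
  qed
qed

lemma meager_translate:
  fixes S :: "'g::topological_group_add set"
  assumes "meager S"
  shows "meager {h. h + k \<in> S}"
proof -
  obtain \<G> where \<G>: "countable \<G>" "\<forall>T\<in>\<G>. closed T \<and> interior T = {}" "S \<subseteq> \<Union>\<G>"
    using \<open>meager S\<close> unfolding meager_def by blast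
  have cont: "continuous_on UNIV (\<lambda>h::'g. h + c)" for c
    by (intro continuous_intros)
  have 1: "closed {h. h + k \<in> T}" if "closed T" for T
    using closed_vimage[OF that cont[of k]] by (simp add: vimage_def)
  have 2: "interior {h. h + k \<in> T} = {}" if "interior T = {}" for T
  proof -
    let ?V = "interior {h. h + k \<in> T}"
    have "open {g. g + (- k) \<in> ?V}"
      using open_vimage[OF open_interior cont[of "-k"]] by (simp add: vimage_def)
    moreover have "{g. g + (- k) \<in> ?V} \<subseteq> T"
    proof safe
      fix g assume "g + - k \<in> ?V"
      then have "(g + - k) + k \<in> T" using interior_subset by blast
      then show "g \<in> T" by (simp add: add.assoc)
    qed
    ultimately have "{g. g + (- k) \<in> ?V} = {}"
      using that by (metis interior_maximal subset_empty)
    moreover have "h \<in> ?V \<Longrightarrow> h + k \<in> {g. g + (- k) \<in> ?V}" for h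
      by (simp add: add.assoc)
    ultimately show ?thesis by blast
  qed
  show ?thesis
    unfolding meager_def
  proof (intro exI conjI ballI)
    show "countable ((\<lambda>T. {h. h + k \<in> T}) ` \<G>)"
      using \<G>(1) by simp
    show "{h. h + k \<in> S} \<subseteq> \<Union> ((\<lambda>T. {h. h + k \<in> T}) ` \<G>)"
      using \<G>(3) by blast
    fix T' assume "T' \<in> (\<lambda>T. {h. h + k \<in> T}) ` \<G>"
    then obtain T where T: "T \<in> \<G>" "T' = {h. h + k \<in> T}" by (elim imageE)
    show "closed T'" "interior T' = {}"
      using \<G>(2) T 1[of T] 2[of T] by simp_all
  qed
qed

lemma open_Collect_mem:
  assumes "open V" "continuous_on UNIV f"
  shows "open {x. f x \<in> V}"
  using open_vimage[OF assms] by (simp add: vimage_def)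

text \<open>
  One of the sets is not meager, hence it is comeager in some nonempty open \<open>V\<close>. If \<open>k\<close> is so small that \<open>V\<close>
  meets its translate, the overlap is open and nonempty and cannot be exhausted by two
  meager sets. Category does here what Haar measure does in the theorem of Steinhaus and Weil.
\<close>

lemma Pettis_countable_cover:
  fixes B :: "nat \<Rightarrow> 'g::{topological_group_add, t2_space} set"
  assumes lc: "locally compact (UNIV :: 'g set)"
    and B: "\<And>i. B i \<in> sets borel" and cover: "(\<Union>i. B i) = UNIV"
  shows "\<exists>i W. open W \<and> 0 \<in> W \<and> (\<forall>k\<in>W. \<exists>h. h \<in> B i \<and> h + k \<in> B i)"
proof -
  obtain V where V: "\<And>i. open (V i)" "\<And>i. meager (B i - V i)" "\<And>i. meager (V i - B i)"
    using borel_set_Baire_property[OF B] by metis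
  have "\<exists>i. V i \<noteq> {}"
  proof (rule ccontr)
    assume "\<not> (\<exists>i. V i \<noteq> {})"
    then have "meager (\<Union>i. B i)" using V(2) by (intro meager_UN) auto
    then show False using interior_meager[OF lc, of UNIV] cover by simp
  qed
  then obtain i a where a: "a \<in> V i" by blast
  define W where "W = {k. a + k \<in> V i}"
  have "open W"
    unfolding W_def by (intro open_Collect_mem[OF V(1)] continuous_intros)
  moreover have "\<exists>h. h \<in> B i \<and> h + k \<in> B i" if "k \<in> W" for k
  proof -
    let ?S = "V i \<inter> {h. h + k \<in> V i}"
    have "open {h. h + k \<in> V i}"
      by (intro open_Collect_mem[OF V(1)] continuous_intros)
    then have "open ?S" using V(1) by auto
    moreover have "a \<in> ?S" using a that by (auto simp: W_def)
    ultimately have "interior ?S \<noteq> {}" by (metis empty_iff interior_open)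
    moreover have "meager ((V i - B i) \<union> {h. h + k \<in> V i - B i})"
      by (intro meager_Un meager_translate V)
    ultimately have "\<not> ?S \<subseteq> (V i - B i) \<union> {h. h + k \<in> V i - B i}"
      using interior_meager[OF lc] meager_subset by blast
    then show ?thesis by blast
  qed
  ultimately show ?thesis
    using a by (intro exI[of _ i] exI[of _ W]) (auto simp: W_def)
qed

section \<open>Countably generated sigma-algebras and separability\<close>

text \<open>
  A measurable subset of a product is generated by countably many rectangles, even when neither
  factor is countably generated. Applied to the preimage of a set under the action, this puts all
  translates of the set into one countably generated sigma-algebra.
\<close>

lemma sections_countably_generated:
  assumes "E \<in> sets (N \<Otimes>\<^sub>M M)"
  shows "\<exists>A. countable A \<and> A \<subseteq> sets M \<and>
    (\<forall>y\<in>space N. {x \<in> space M. (y, x) \<in> E} \<in> sigma_sets (space M) A)"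
proof -
  have "E \<in> sigma_sets (space N \<times> space M) {a \<times> b | a b. a \<in> sets N \<and> b \<in> sets M}"
    using assms by (simp add: sets_pair_measure)
  then show ?thesis
  proof induction
    case (Basic c)
    then obtain a b where ab: "c = a \<times> b" "a \<in> sets N" "b \<in> sets M" by blast
    have "{x \<in> space M. (y, x) \<in> c} \<in> sigma_sets (space M) {b}" for y
    proof (cases "y \<in> a")
      case True
      then have "{x \<in> space M. (y, x) \<in> c} = b"
        using ab sets.sets_into_space by fastforce
      then show ?thesis by (simp add: sigma_sets.Basic)
    next
      case False
      then have "{x \<in> space M. (y, x) \<in> c} = {}" using ab by auto
      then show ?thesis by (simp only: sigma_sets.Empty)
    qed
    then show ?case using ab by (intro exI[of _ "{b}"]) simp
  next
    case Empty
    have "{} \<in> sigma_sets (space M) {}" by (rule sigma_sets.Empty)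
    then show ?case by (intro exI[of _ "{}"]) simp
  next
    case (Compl a)
    then obtain A where A: "countable A" "A \<subseteq> sets M"
      "\<forall>y\<in>space N. {x \<in> space M. (y, x) \<in> a} \<in> sigma_sets (space M) A" by blast
    have "{x \<in> space M. (y, x) \<in> space N \<times> space M - a} = space M - {x \<in> space M. (y, x) \<in> a}"
      if "y \<in> space N" for y using that by auto
    moreover have "\<forall>y\<in>space N. space M - {x \<in> space M. (y, x) \<in> a} \<in> sigma_sets (space M) A"
      using A(3) by (blast intro: sigma_sets.Compl)
    ultimately show ?case using A(1,2) by (intro exI[of _ A]) simp
  next
    case (Union a)
    then have "\<forall>i. \<exists>A. countable A \<and> A \<subseteq> sets M \<and>
      (\<forall>y\<in>space N. {x \<in> space M. (y, x) \<in> a i} \<in> sigma_sets (space M) A)" by simp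
    from choice[OF this] obtain A where "\<forall>i. countable (A i) \<and> A i \<subseteq> sets M \<and>
      (\<forall>y\<in>space N. {x \<in> space M. (y, x) \<in> a i} \<in> sigma_sets (space M) (A i))" ..
    then have A: "countable (A i)" "A i \<subseteq> sets M"
      "\<forall>y\<in>space N. {x \<in> space M. (y, x) \<in> a i} \<in> sigma_sets (space M) (A i)" for i by simp_all
    show ?case
    proof (intro exI conjI ballI)
      show "countable (\<Union>i. A i)" "(\<Union>i. A i) \<subseteq> sets M" using A(1,2) by (simp_all add: UN_least)
      fix y assume y: "y \<in> space N"
      have "{x \<in> space M. (y, x) \<in> (\<Union>i. a i)} = (\<Union>i. {x \<in> space M. (y, x) \<in> a i})" by auto
      moreover have "{x \<in> space M. (y, x) \<in> a i} \<in> sigma_sets (space M) (\<Union>i. A i)" for i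
      proof -
        have "sigma_sets (space M) (A i) \<subseteq> sigma_sets (space M) (\<Union>i. A i)"
          by (intro sigma_sets_mono') auto
        then show ?thesis using A(3)[of i] y by blast
      qed
      ultimately show "{x \<in> space M. (y, x) \<in> (\<Union>i. a i)} \<in> sigma_sets (space M) (\<Union>i. A i)"
        using sigma_sets.Union[of "\<lambda>i. {x \<in> space M. (y, x) \<in> a i}"] by simp
    qed
  qed
qed

lemma ex_countable_algebra:
  assumes "countable A" "A \<subseteq> Pow \<Omega>"
  shows "\<exists>\<A>. countable \<A> \<and> A \<subseteq> \<A> \<and> algebra \<Omega> \<A> \<and> \<A> \<subseteq> sigma_sets \<Omega> A"
proof -
  define c where "c = rec_nat (insert {} A)
    (\<lambda>_ C. C \<union> (\<lambda>a. \<Omega> - a) ` C \<union> (\<lambda>(a, b). a \<union> b) ` (C \<times> C))"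
  have c0: "c 0 = insert {} A"
    and cS: "c (Suc n) = c n \<union> (\<lambda>a. \<Omega> - a) ` c n \<union> (\<lambda>(a, b). a \<union> b) ` (c n \<times> c n)" for n
    by (simp_all add: c_def)
  have mono: "c m \<subseteq> c n" if "m \<le> n" for m n
    using that by (rule lift_Suc_mono_le[rotated]) (auto simp: cS)
  have cnt: "countable (c n)" for n
    using assms(1) by (induction n) (simp_all add: c0 cS)
  have sub: "c n \<subseteq> sigma_sets \<Omega> A" for n
  proof (induction n)
    case 0
    show ?case by (auto simp: c0 intro: sigma_sets.intros)
  next
    case (Suc n)
    then show ?case
      by (auto simp: cS intro: sigma_sets.Compl sigma_sets_Un)
  qed
  have "algebra \<Omega> (\<Union>n. c n)"
    unfolding algebra_iff_Un
  proof (intro conjI ballI)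
    show "(\<Union>n. c n) \<subseteq> Pow \<Omega>"
      using sub sigma_sets_into_sp[OF assms(2)] by blast
    show "{} \<in> (\<Union>n. c n)" using c0 by auto
    fix a assume "a \<in> (\<Union>n. c n)"
    then obtain m where m: "a \<in> c m" by blast
    then have "\<Omega> - a \<in> c (Suc m)" by (auto simp: cS)
    then show "\<Omega> - a \<in> (\<Union>n. c n)" by blast
    fix b assume "b \<in> (\<Union>n. c n)"
    then obtain n where n: "b \<in> c n" by blast
    have "a \<in> c (max m n)" "b \<in> c (max m n)"
      using m n mono[of m "max m n"] mono[of n "max m n"] by auto
    then have "a \<union> b \<in> c (Suc (max m n))" by (auto simp: cS)
    then show "a \<union> b \<in> (\<Union>n. c n)" by blast
  qed
  moreover have "A \<subseteq> (\<Union>n. c n)" using c0 by blast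
  ultimately show ?thesis
    using cnt sub by (intro exI[of _ "\<Union>n. c n"]) auto
qed

lemma (in finite_measure) finite_emeasure_less_top: "emeasure M A < \<infinity>"
  unfolding infinity_ennreal_def by (rule top.not_eq_extremum[THEN iffD1, OF emeasure_finite])

lemma (in finite_measure) measure_diff_le_sym_diff:
  assumes "E \<in> sets M" "A \<in> sets M"
  shows "\<bar>measure M E - measure M A\<bar> \<le> measure M (sym_diff E A)"
proof -
  have "measure M E \<le> measure M (A \<union> sym_diff E A)" "measure M A \<le> measure M (E \<union> sym_diff E A)"
    using assms by (auto intro!: finite_measure_mono)
  moreover have "measure M (A \<union> sym_diff E A) \<le> measure M A + measure M (sym_diff E A)"
    "measure M (E \<union> sym_diff E A) \<le> measure M E + measure M (sym_diff E A)"
    using assms by (intro measure_Un_le; auto)+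
  ultimately show ?thesis by linarith
qed

text \<open>
  The sets that can be approximated form a sigma-algebra: for a countable union, cut off a tail of small measure
  and approximate the finitely many remaining sets.
\<close>

lemma (in finite_measure) algebra_approximation:
  assumes alg: "algebra (space M) \<A>" and gen: "sets M = sigma_sets (space M) \<A>"
    and "E \<in> sets M" "e > 0"
  shows "\<exists>A\<in>\<A>. measure M (sym_diff E A) < e"
proof -
  interpret A: algebra "space M" \<A> by fact
  have sub: "A \<in> \<A> \<Longrightarrow> A \<in> sets M" for A by (simp add: gen sigma_sets.Basic)
  have "E \<in> sigma_sets (space M) \<A>" using assms by simp
  then show ?thesis
    using \<open>e > 0\<close>
  proof (induction arbitrary: e)
    case (Basic a)
    then show ?case by (intro bexI[of _ a]) auto
  next
    case Empty
    then show ?case by (intro bexI[of _ "{}"]) auto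
  next
    case (Compl a)
    then obtain A where A: "A \<in> \<A>" "measure M (sym_diff a A) < e" by blast
    have "a \<subseteq> space M" "A \<subseteq> space M"
      using Compl.hyps sub[OF A(1)] sets.sets_into_space by (auto simp: gen[symmetric])
    then have "sym_diff (space M - a) (space M - A) = sym_diff a A" by auto
    then show ?case using A by (intro bexI[of _ "space M - A"]) auto
  next
    case (Union a)
    have a: "a i \<in> sets M" for i using Union.hyps by (simp add: gen)
    define U where "U n = (\<Union>i<n. a i)" for n
    have "(\<lambda>n. measure M (U n)) \<longlonglongrightarrow> measure M (\<Union>n. U n)"
      using a by (intro finite_Lim_measure_incseq) (force simp: U_def incseq_def)+
    moreover have "(\<Union>n. U n) = (\<Union>i. a i)" by (auto simp: U_def)
    ultimately have "\<forall>\<^sub>F n in sequentially. dist (measure M (U n)) (measure M (\<Union>i. a i)) < e / 2"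
      using Union.prems by (intro tendstoD) auto
    then obtain n where n: "dist (measure M (U n)) (measure M (\<Union>i. a i)) < e / 2"
      using eventually_happens'[OF sequentially_bot] by blast
    have "measure M ((\<Union>i. a i) - U n) = measure M (\<Union>i. a i) - measure M (U n)"
      using a by (intro finite_measure_Diff) (auto simp: U_def)
    then have n: "measure M ((\<Union>i. a i) - U n) < e / 2"
      using n unfolding dist_real_def by linarith
    have "e / (2 * Suc n) > 0" using Union.prems by simp
    then have "\<forall>i. \<exists>A\<in>\<A>. measure M (sym_diff (a i) A) < e / (2 * Suc n)"
      using Union.IH by blast
    then obtain A where A: "\<And>i. A i \<in> \<A>" "\<And>i. measure M (sym_diff (a i) (A i)) < e / (2 * Suc n)"
      by metis
    have Am: "A i \<in> sets M" for i using A sub by blast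
    have UA: "(\<Union>i<n. A i) \<in> \<A>" using A(1) by (intro A.finite_UN) auto
    have "measure M (sym_diff (\<Union>i. a i) (\<Union>i<n. A i))
      \<le> measure M (((\<Union>i. a i) - U n) \<union> (\<Union>i<n. sym_diff (a i) (A i)))"
      using a Am by (intro finite_measure_mono) (auto simp: U_def)
    also have "\<dots> \<le> measure M ((\<Union>i. a i) - U n) + measure M (\<Union>i<n. sym_diff (a i) (A i))"
      using a Am by (intro measure_Un_le) (auto simp: U_def)
    also have "measure M (\<Union>i<n. sym_diff (a i) (A i)) \<le> (\<Sum>i<n. measure M (sym_diff (a i) (A i)))"
      using a Am by (intro finite_measure_subadditive_finite) auto
    also have "\<dots> \<le> (\<Sum>i<n. e / (2 * Suc n))"
      using A(2) by (intro sum_mono less_imp_le)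
    also have "\<dots> \<le> e / 2" using Union.prems by (simp add: field_simps)
    finally show ?case using n UA by (intro bexI[of _ "\<Union>i<n. A i"]) auto
  qed
qed

definition rational_step :: "(rat \<times> 'x set) list \<Rightarrow> 'x \<Rightarrow> real" where
  "rational_step xs x = (\<Sum>(q, a)\<leftarrow>xs. of_rat q * indicator a x)"

lemma rational_step_simps:
  "rational_step [] x = 0"
  "rational_step ((q, a) # xs) x = of_rat q * indicator a x + rational_step xs x"
  "rational_step (xs @ ys) x = rational_step xs x + rational_step ys x"
  by (simp_all add: rational_step_def)

lemma (in finite_measure) integrable_rational_step:
  assumes "xs \<in> lists (UNIV \<times> sets M)"
  shows "integrable M (rational_step xs)"
proof -
  have "integrable M (\<lambda>x. rational_step xs x)"
    using assms
  proof (induction xs)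
    case (Cons y xs)
    obtain q a where y: "y = (q, a)" by force
    have "a \<in> sets M" using Cons by (auto simp: y)
    then have "integrable M (\<lambda>x. of_rat q * indicator a x :: real)"
      by (intro integrable_mult_right integrable_real_indicator finite_emeasure_less_top)
    then show ?case using Cons unfolding y by (simp add: rational_step_simps)
  qed (simp add: rational_step_simps)
  then show ?thesis by simp
qed

text \<open>
  When \<open>\<A>\<close> is countable, so is the set of these step functions; this is the separability of \<open>L\<^sup>1\<close>.
\<close>

lemma (in finite_measure) rational_step_dense:
  assumes alg: "algebra (space M) \<A>" and gen: "sets M = sigma_sets (space M) \<A>"
    and "integrable M f" "e > 0"
  shows "\<exists>xs\<in>lists (UNIV \<times> \<A>). (LINT x|M. \<bar>f x - rational_step xs x\<bar>) < e"
proof -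
  have step: "integrable M (rational_step xs)" if "xs \<in> lists (UNIV \<times> \<A>)" for xs
  proof -
    have "\<A> \<subseteq> sets M" unfolding gen by blast
    then have "xs \<in> lists (UNIV \<times> sets M)" using that by (auto simp: in_lists_conv_set)
    then show ?thesis by (rule integrable_rational_step)
  qed
  show ?thesis
    using \<open>integrable M f\<close> \<open>e > 0\<close>
  proof (induction f arbitrary: e rule: integrable_induct)
    case (base E c)
    define m where "m = measure M (space M) + 1"
    have m: "m > 0" "measure M E \<le> m" for E
      unfolding m_def using bounded_measure[of E] measure_nonneg[of M "space M"] by linarith+
    obtain q where q: "c < of_rat q" "of_rat q < c + e / (2 * m)"
      using of_rat_dense[of c "c + e / (2 * m)"] m(1) base by auto
    have pos: "\<bar>of_rat q\<bar> + 1 > (0::real)" by (intro add_nonneg_pos) simp_all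
    then have "e / (2 * (\<bar>of_rat q\<bar> + 1)) > (0::real)"
      using base by (intro divide_pos_pos mult_pos_pos) simp_all
    then obtain A where A: "A \<in> \<A>" "measure M (sym_diff E A) < e / (2 * (\<bar>of_rat q\<bar> + 1))"
      using algebra_approximation[OF alg gen base(1)] by blast
    have [measurable]: "E \<in> sets M" "A \<in> sets M" using base A gen by auto
    let ?s = "\<lambda>x. (of_rat q - c) * indicator E x + \<bar>of_rat q\<bar> * indicator (sym_diff E A) x"
    have "(LINT x|M. \<bar>indicator E x *\<^sub>R c - rational_step [(q, A)] x\<bar>) \<le> (LINT x|M. ?s x)"
    proof (rule integral_mono)
      show "integrable M (\<lambda>x. \<bar>indicator E x *\<^sub>R c - rational_step [(q, A)] x\<bar>)"
        using A(1)
        by (intro integrable_abs Bochner_Integration.integrable_diff integrable_scaleR_left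
            integrable_real_indicator finite_emeasure_less_top step) simp_all
      show "integrable M ?s"
        by (intro Bochner_Integration.integrable_add integrable_mult_right
            integrable_real_indicator finite_emeasure_less_top) simp_all
      show "\<bar>indicator E x *\<^sub>R c - rational_step [(q, A)] x\<bar> \<le> ?s x" for x
      proof -
        have "\<bar>c\<bar> \<le> (of_rat q - c) + \<bar>of_rat q\<bar>" using q(1) by linarith
        then show ?thesis
          using q(1) by (auto simp: rational_step_simps indicator_def simp del: abs_of_rat)
      qed
    qed
    also have "\<dots> = (of_rat q - c) * measure M E + \<bar>of_rat q\<bar> * measure M (sym_diff E A)"
    proof (subst Bochner_Integration.integral_add)
      show "integrable M (\<lambda>x. (of_rat q - c) * indicator E x)"
        "integrable M (\<lambda>x. \<bar>of_rat q\<bar> * indicator (sym_diff E A) x :: real)"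
        by (intro integrable_mult_right integrable_real_indicator finite_emeasure_less_top; simp)+
    qed simp
    also have "(of_rat q - c) * measure M E \<le> (e / (2 * m)) * m"
      using q m(1) m(2)[of E] by (intro mult_mono) auto
    also have "(e / (2 * m)) * m = e / 2" using m by simp
    also have "\<bar>of_rat q\<bar> * measure M (sym_diff E A) \<le> (\<bar>of_rat q\<bar> + 1) * measure M (sym_diff E A)"
      by (intro mult_right_mono) auto
    also have "\<dots> < (\<bar>of_rat q\<bar> + 1) * (e / (2 * (\<bar>of_rat q\<bar> + 1)))"
      using A(2) pos by (intro mult_strict_left_mono) auto
    also have "\<dots> = e / 2" using pos by (simp add: field_simps)
    finally show ?case using A(1) by (intro bexI[of _ "[(q, A)]"]) auto
  next
    case (add f g)
    have "e / 2 > 0" using add.prems by simp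
    then obtain xs ys where xy: "xs \<in> lists (UNIV \<times> \<A>)" "ys \<in> lists (UNIV \<times> \<A>)"
      "(LINT x|M. \<bar>f x - rational_step xs x\<bar>) < e / 2" "(LINT x|M. \<bar>g x - rational_step ys x\<bar>) < e / 2"
      using add.IH by meson
    note int = add.hyps step[OF xy(1)] step[OF xy(2)]
    have "(LINT x|M. \<bar>f x + g x - rational_step (xs @ ys) x\<bar>)
      \<le> (LINT x|M. \<bar>f x - rational_step xs x\<bar> + \<bar>g x - rational_step ys x\<bar>)"
      using int by (intro integral_mono) (auto simp: rational_step_simps)
    also have "\<dots> = (LINT x|M. \<bar>f x - rational_step xs x\<bar>) + (LINT x|M. \<bar>g x - rational_step ys x\<bar>)"
      using int by (intro Bochner_Integration.integral_add) auto
    finally show ?case using xy by (intro bexI[of _ "xs @ ys"]) auto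
  next
    case (lim f s)
    have "(\<lambda>i. LINT x|M. \<bar>f x - s i x\<bar>) \<longlonglongrightarrow> (LINT x|M. 0)"
    proof (rule integral_dominated_convergence[where w = "\<lambda>x. 3 * \<bar>f x\<bar>"])
      show "AE x in M. (\<lambda>i. \<bar>f x - s i x\<bar>) \<longlonglongrightarrow> 0"
      proof (intro AE_I2)
        fix x assume "x \<in> space M"
        then have "(\<lambda>i. \<bar>f x - s i x\<bar>) \<longlonglongrightarrow> \<bar>f x - f x\<bar>"
          by (intro tendsto_intros lim.hyps(2))
        then show "(\<lambda>i. \<bar>f x - s i x\<bar>) \<longlonglongrightarrow> 0" by simp
      qed
      show "AE x in M. norm \<bar>f x - s i x\<bar> \<le> 3 * \<bar>f x\<bar>" for i
      proof (intro AE_I2)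
        fix x assume "x \<in> space M"
        then have "\<bar>s i x\<bar> \<le> 2 * \<bar>f x\<bar>" using lim.hyps(3) by simp
        then show "norm \<bar>f x - s i x\<bar> \<le> 3 * \<bar>f x\<bar>" by simp
      qed
    qed (use lim.hyps(1,4) in simp_all)
    then have "\<forall>\<^sub>F i in sequentially. dist (LINT x|M. \<bar>f x - s i x\<bar>) 0 < e / 2"
      using lim.prems by (intro tendstoD) auto
    then obtain i where "dist (LINT x|M. \<bar>f x - s i x\<bar>) 0 < e / 2"
      using eventually_happens'[OF sequentially_bot] by blast
    then have i: "(LINT x|M. \<bar>f x - s i x\<bar>) < e / 2" by simp
    have "e / 2 > 0" using lim.prems by simp
    then obtain xs where xs: "xs \<in> lists (UNIV \<times> \<A>)" "(LINT x|M. \<bar>s i x - rational_step xs x\<bar>) < e / 2"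
      using lim.IH by meson
    have int: "integrable M (\<lambda>x. \<bar>f x - s i x\<bar>)" "integrable M (\<lambda>x. \<bar>s i x - rational_step xs x\<bar>)"
      "integrable M (\<lambda>x. \<bar>f x - rational_step xs x\<bar>)"
      using lim.hyps(1,4) step[OF xs(1)] by simp_all
    have "(LINT x|M. \<bar>f x - rational_step xs x\<bar>)
      \<le> (LINT x|M. \<bar>f x - s i x\<bar> + \<bar>s i x - rational_step xs x\<bar>)"
      using int by (intro integral_mono) auto
    also have "\<dots> = (LINT x|M. \<bar>f x - s i x\<bar>) + (LINT x|M. \<bar>s i x - rational_step xs x\<bar>)"
      using int by (intro Bochner_Integration.integral_add) auto
    finally show ?case using xs i by (intro bexI[of _ xs]) auto
  qed
qed

lemma (in finite_measure) dominated_real_density: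
  assumes Q: "finite_measure Q" "sets Q = sets M" "absolutely_continuous M Q"
  obtains D where "integrable M D" "\<And>x. 0 \<le> D x" "\<And>E. E \<in> sets M \<Longrightarrow> measure Q E = (LINT x|M. D x * indicator E x)"
proof -
  interpret Q: finite_measure Q by fact
  define D where "D x = enn2real (RN_deriv M Q x)" for x
  show ?thesis
  proof (rule that[of D])
    have "integrable M (\<lambda>x. D x * 1)"
      unfolding D_def
      by (subst RN_deriv_integrable[OF Q.sigma_finite_measure_axioms Q(3,2), symmetric])
        (auto simp: Q.integrable_const)
    then show "integrable M D" by simp
    fix E assume "E \<in> sets M"
    then show "measure Q E = (LINT x|M. D x * indicator E x)"
      unfolding D_def
      by (subst RN_deriv_integral[OF Q.sigma_finite_measure_axioms Q(3,2), symmetric])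
        (auto simp: Q(2) sets_eq_imp_space_eq[OF Q(2)] Int_absorb2 sets.sets_into_space)
  qed (simp add: D_def)
qed

text \<open>
  Over a countably generated sigma-algebra the dominated finite measures are separable in total variation, because
  their densities lie in a separable \<open>L\<^sup>1\<close>; the set functions \<open>s i\<close> are the integrals of rational
  step functions. Moreover the distance of two such measures can be read off from a countable
  algebra, by approximation with respect to their sum. The second fact is what makes the balls of small radius
  Borel when the measures depend on a parameter.
\<close>

lemma (in finite_measure) dominated_measures_separable:
  assumes gen: "sets M = sigma_sets (space M) A" and A: "countable A" "A \<subseteq> sets M"
  obtains \<A> s where "countable \<A>" "\<A> \<subseteq> sets M"
    "\<And>Q e. \<lbrakk>finite_measure Q; sets Q = sets M; absolutely_continuous M Q; e > 0\<rbrakk>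
      \<Longrightarrow> \<exists>i::nat. \<forall>E\<in>sets M. \<bar>measure Q E - s i E\<bar> \<le> (e :: real)"
    "\<And>Q Q' c. \<lbrakk>finite_measure Q; sets Q = sets M; absolutely_continuous M Q;
      finite_measure Q'; sets Q' = sets M; absolutely_continuous M Q';
      \<forall>E\<in>\<A>. \<bar>measure Q E - measure Q' E\<bar> \<le> c\<rbrakk> \<Longrightarrow> \<forall>E\<in>sets M. \<bar>measure Q E - measure Q' E\<bar> \<le> c"
proof -
  have "A \<subseteq> Pow (space M)" using A(2) sets.space_closed by (rule order_trans)
  from ex_countable_algebra[OF A(1) this] obtain \<A>
    where \<A>: "countable \<A>" "A \<subseteq> \<A>" "algebra (space M) \<A>" "\<A> \<subseteq> sigma_sets (space M) A"
    by (elim exE conjE)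
  have \<A>M: "\<A> \<subseteq> sets M" using \<A> gen by simp
  have gen': "sets M = sigma_sets (space M) \<A>"
  proof
    show "sets M \<subseteq> sigma_sets (space M) \<A>" unfolding gen by (intro sigma_sets_mono' \<A>)
    show "sigma_sets (space M) \<A> \<subseteq> sets M" using \<A>M by (rule sets.sigma_sets_subset)
  qed
  define S where "S = lists (UNIV \<times> \<A> :: (rat \<times> 'a set) set)"
  have S: "countable S" using \<A>(1) by (simp add: S_def)
  define s where "s i E = (LINT x|M. rational_step (from_nat_into S i) x * indicator E x)" for i E
  show ?thesis
  proof (rule that[OF \<A>(1) \<A>M])
    fix Q :: "'a measure" and e :: real
    assume Q: "finite_measure Q" "sets Q = sets M" "absolutely_continuous M Q" and e: "e > 0"
    obtain D where D: "integrable M D" "\<And>x. 0 \<le> D x"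
      "\<And>E. E \<in> sets M \<Longrightarrow> measure Q E = (LINT x|M. D x * indicator E x)"
      using dominated_real_density[OF Q] by metis
    obtain xs where xs: "xs \<in> S" "(LINT x|M. \<bar>D x - rational_step xs x\<bar>) < e"
      using rational_step_dense[OF \<A>(3) gen' D(1) e] by (auto simp: S_def)
    obtain i where i: "from_nat_into S i = xs" using from_nat_into_surj[OF S xs(1)] by blast
    have intS: "integrable M (rational_step xs)"
    proof -
      have "xs \<in> lists (UNIV \<times> sets M)" using xs(1) \<A>M by (auto simp: S_def in_lists_conv_set)
      then show ?thesis by (rule integrable_rational_step)
    qed
    have "\<bar>measure Q E - s i E\<bar> \<le> e" if E: "E \<in> sets M" for E
    proof -
      note int = integrable_real_mult_indicator[OF E D(1)] integrable_real_mult_indicator[OF E intS]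
      have "measure Q E - s i E = (LINT x|M. D x * indicator E x - rational_step xs x * indicator E x)"
        unfolding D(3)[OF E] s_def i using int by simp
      also have "\<bar>\<dots>\<bar> \<le> (LINT x|M. \<bar>D x * indicator E x - rational_step xs x * indicator E x\<bar>)"
        by (rule integral_abs_bound)
      also have "\<dots> \<le> (LINT x|M. \<bar>D x - rational_step xs x\<bar>)"
        using int D(1) intS by (intro integral_mono) (auto simp: indicator_def)
      finally show ?thesis using xs(2) by simp
    qed
    then show "\<exists>i. \<forall>E\<in>sets M. \<bar>measure Q E - s i E\<bar> \<le> e" by blast
  next
    fix Q Q' :: "'a measure" and c :: real
    assume Q: "finite_measure Q" "sets Q = sets M" "absolutely_continuous M Q"
      and Q': "finite_measure Q'" "sets Q' = sets M" "absolutely_continuous M Q'"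
      and c: "\<forall>E\<in>\<A>. \<bar>measure Q E - measure Q' E\<bar> \<le> c"
    interpret Q: finite_measure Q by fact
    interpret Q': finite_measure Q' by fact
    obtain D where D: "integrable M D" "\<And>x. 0 \<le> D x"
      "\<And>E. E \<in> sets M \<Longrightarrow> measure Q E = (LINT x|M. D x * indicator E x)"
      using dominated_real_density[OF Q] by metis
    obtain D' where D': "integrable M D'" "\<And>x. 0 \<le> D' x"
      "\<And>E. E \<in> sets M \<Longrightarrow> measure Q' E = (LINT x|M. D' x * indicator E x)"
      using dominated_real_density[OF Q'] by metis
    \<comment> \<open>the sum of the two measures\<close>
    define P where "P = density M (\<lambda>x. ennreal (D x + D' x))"
    have int: "integrable M (\<lambda>x. D x + D' x)" using D(1) D'(1) by simp
    have emP: "emeasure P E = ennreal (measure Q E + measure Q' E)" if E: "E \<in> sets M" for E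
    proof -
      note intE = integrable_real_mult_indicator[OF E D(1)] integrable_real_mult_indicator[OF E D'(1)]
      have "emeasure P E = (\<integral>\<^sup>+x. ennreal ((D x + D' x) * indicator E x) \<partial>M)"
        unfolding P_def using E int
        by (subst emeasure_density) (auto intro!: nn_integral_cong simp: indicator_def)
      also have "\<dots> = ennreal (LINT x|M. (D x + D' x) * indicator E x)"
        using int D(2) D'(2) integrable_real_mult_indicator[OF E int]
        by (intro nn_integral_eq_integral) auto
      also have "(LINT x|M. (D x + D' x) * indicator E x) = measure Q E + measure Q' E"
        unfolding D(3)[OF E] D'(3)[OF E] using intE by (simp add: distrib_right)
      finally show ?thesis .
    qed
    have P: "measure P E = measure Q E + measure Q' E" if "E \<in> sets M" for E
      unfolding measure_def[of P] emP[OF that] by (simp del: ennreal_plus)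
    have PM: "space P = space M" "sets P = sets M" by (simp_all add: P_def)
    then have "emeasure P (space P) \<noteq> \<infinity>" using emP[OF sets.top] by simp
    then interpret P: finite_measure P by (rule finite_measureI)
    show "\<forall>E\<in>sets M. \<bar>measure Q E - measure Q' E\<bar> \<le> c"
    proof (rule ballI, rule field_le_epsilon)
      fix E and e :: real assume E: "E \<in> sets M" and e: "e > 0"
      have "\<exists>B\<in>\<A>. measure P (sym_diff E B) < e"
      proof (rule P.algebra_approximation)
        show "algebra (space P) \<A>" unfolding PM by (rule \<A>(3))
        show "sets P = sigma_sets (space P) \<A>" unfolding PM by (rule gen')
        show "E \<in> sets P" unfolding PM by (rule E)
      qed (rule e)
      then obtain B where B: "B \<in> \<A>" "measure P (sym_diff E B) < e" ..
      have BM: "B \<in> sets M" using \<A>M B(1) by (rule subsetD)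
      have "\<bar>measure Q E - measure Q B\<bar> \<le> measure Q (sym_diff E B)"
        "\<bar>measure Q' E - measure Q' B\<bar> \<le> measure Q' (sym_diff E B)"
        by (intro Q.measure_diff_le_sym_diff Q'.measure_diff_le_sym_diff; simp add: Q Q' E BM)+
      moreover have "measure Q (sym_diff E B) + measure Q' (sym_diff E B) < e"
        using B(2) P[of "sym_diff E B"] E BM by simp
      moreover have "\<bar>measure Q B - measure Q' B\<bar> \<le> c" using c B(1) by blast
      ultimately show "\<bar>measure Q E - measure Q' E\<bar> \<le> c + e" by linarith
    qed
  qed
qed

section \<open>Continuity of translation in total variation\<close>

locale nonsingular_action = sigma_finite_measure M for M :: "'x measure" +
  fixes \<pi> :: "'g::{topological_group_add, second_countable_topology, t2_space} \<Rightarrow> 'x \<Rightarrow> 'x"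
  assumes locally_compact_group: "locally compact (UNIV :: 'g set)"
    and act_add: "x \<in> space M \<Longrightarrow> \<pi> (g + h) x = \<pi> g (\<pi> h x)"
    and act_zero: "x \<in> space M \<Longrightarrow> \<pi> 0 x = x"
    and measurable_act: "(\<lambda>(g, x). \<pi> g x) \<in> borel \<Otimes>\<^sub>M M \<rightarrow>\<^sub>M M"
    and nonsingular: "absolutely_continuous M (distr M M (\<pi> g))"
begin

lemma measurable_act_compose [measurable (raw)]:
  assumes "f \<in> N \<rightarrow>\<^sub>M borel" "h \<in> N \<rightarrow>\<^sub>M M"
  shows "(\<lambda>y. \<pi> (f y) (h y)) \<in> N \<rightarrow>\<^sub>M M"
  using measurable_compose[OF measurable_Pair[OF assms] measurable_act] by simp

lemma act_space [simp]: "x \<in> space M \<Longrightarrow> \<pi> g x \<in> space M"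
  using measurable_space[OF measurable_act_compose[of "\<lambda>_. g" M "\<lambda>x. x"]] by simp

lemma act_minus [simp]:
  assumes "x \<in> space M"
  shows "\<pi> (- g) (\<pi> g x) = x" "\<pi> g (\<pi> (- g) x) = x"
  using act_add[OF assms, of "- g" g] act_add[OF assms, of g "- g"] act_zero[OF assms] by simp_all

lemma uminus_measurable [measurable]: "(uminus :: 'g \<Rightarrow> 'g) \<in> borel \<rightarrow>\<^sub>M borel"
  by (intro borel_measurable_continuous_onI continuous_intros)

lemma AE_act: "AE x in M. P x \<Longrightarrow> AE x in M. P (\<pi> g x)"
  by (rule AE_distrD[OF _ absolutely_continuous_AE[OF _ nonsingular]]) simp_all

lemma measurable_measure_act:
  assumes "E \<in> sets M"
  shows "(\<lambda>g. measure M (\<pi> g -` E \<inter> space M)) \<in> borel_measurable borel"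
proof -
  have "{y \<in> space (borel \<Otimes>\<^sub>M M). snd y \<in> \<pi> (fst y) -` E \<inter> space M} =
    (\<lambda>(g, x). \<pi> g x) -` E \<inter> space (borel \<Otimes>\<^sub>M M)"
    by (auto simp: space_pair_measure)
  then have "(\<lambda>g. emeasure M (\<pi> g -` E \<inter> space M)) \<in> borel_measurable borel"
    by (intro measurable_emeasure) (use measurable_sets[OF measurable_act assms] in auto)
  then show ?thesis unfolding measure_def by simp
qed

lemma act_vimage_sets [measurable]: "E \<in> sets M \<Longrightarrow> \<pi> g -` E \<inter> space M \<in> sets M"
  by measurable

text \<open>
  Comparing the images of \<open>M\<close> under \<open>\<pi> (h + k)\<close> and \<open>\<pi> h\<close> on the set \<open>\<pi> h E\<close> amounts to comparing the image under
  \<open>\<pi> k\<close> with \<open>M\<close> itself on \<open>E\<close>. This is why the countably generated sigma-algebra has to contain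
  all translates of the sets \<open>E n\<close> that witness a failure of continuity.
\<close>

lemma translates_TV_continuous:
  assumes "finite_measure M" "e > 0"
  shows "\<exists>W. open W \<and> 0 \<in> W \<and> (\<forall>k\<in>W. \<forall>E\<in>sets M. \<bar>measure M (\<pi> k -` E \<inter> space M) - measure M E\<bar> \<le> e)"
proof (rule ccontr)
  assume neg: "\<not> ?thesis"
  interpret fin: finite_measure M by fact
  obtain N :: "nat \<Rightarrow> 'g set" where N: "\<And>i. open (N i)" "\<And>i. 0 \<in> N i"
    "\<And>S. open S \<Longrightarrow> 0 \<in> S \<Longrightarrow> eventually (\<lambda>i. N i \<subseteq> S) sequentially"
    using countable_basis_at_decseq[of 0] by metis
  have "\<forall>n. \<exists>k E. k \<in> N n \<and> E \<in> sets M \<and> \<bar>measure M (\<pi> k -` E \<inter> space M) - measure M E\<bar> > e"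
    using neg N(1,2) by (meson not_le)
  then obtain k E where kE: "\<And>n. k n \<in> N n" "\<And>n. E n \<in> sets M"
    "\<And>n. \<bar>measure M (\<pi> (k n) -` E n \<inter> space M) - measure M (E n)\<bar> > e"
    by metis
  have "\<exists>A. countable A \<and> A \<subseteq> sets M \<and> (\<forall>h. \<pi> (- h) -` E n \<inter> space M \<in> sigma_sets (space M) A)" for n
  proof -
    let ?F = "(\<lambda>(h, x). \<pi> (- h) x) -` E n \<inter> space (borel \<Otimes>\<^sub>M M)"
    have F: "?F \<in> sets (borel \<Otimes>\<^sub>M M)"
      using kE(2)[of n] by measurable
    have eq: "{x \<in> space M. (h, x) \<in> (\<lambda>(h, x). \<pi> (- h) x) -` E n \<inter> space (borel \<Otimes>\<^sub>M M)}
      = \<pi> (- h) -` E n \<inter> space M" for h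
      by (auto simp: space_pair_measure)
    show ?thesis
      using sections_countably_generated[OF F] unfolding eq by simp
  qed
  then have "\<forall>n. \<exists>A. countable A \<and> A \<subseteq> sets M \<and> (\<forall>h. \<pi> (- h) -` E n \<inter> space M \<in> sigma_sets (space M) A)"
    by (rule allI)
  from choice[OF this] obtain A where "\<forall>n. countable (A n) \<and> A n \<subseteq> sets M \<and>
    (\<forall>h. \<pi> (- h) -` E n \<inter> space M \<in> sigma_sets (space M) (A n))" ..
  then have A: "countable (A n)" "A n \<subseteq> sets M"
    "\<pi> (- h) -` E n \<inter> space M \<in> sigma_sets (space M) (A n)" for n h
    by simp_all
  \<comment> \<open>a sigma-algebra that is countably generated and contains all translates of all \<open>E n\<close>\<close>
  define C where "C = sigma (space M) (\<Union>n. A n)"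
  have AM: "(\<Union>n. A n) \<subseteq> sets M" using A(2) by (rule UN_least)
  then have APow: "(\<Union>n. A n) \<subseteq> Pow (space M)" using sets.space_closed by (rule order_trans)
  have C: "sets C = sigma_sets (space M) (\<Union>n. A n)" "space C = space M"
    using APow by (simp_all add: C_def)
  have CM: "sets C \<subseteq> sets M" unfolding C using AM by (rule sets.sigma_sets_subset)
  have MC: "f \<in> M \<rightarrow>\<^sub>M M \<Longrightarrow> f \<in> M \<rightarrow>\<^sub>M C" for f
    using CM C(2) by (auto simp: measurable_def)
  have transl: "\<pi> (- h) -` E n \<inter> space M \<in> sets C" for h n
    using A(3)[of h n] sigma_sets_mono'[of "A n" "\<Union>n. A n" "space M"] by (auto simp: C)
  define P where "P = distr M C (\<lambda>x. x)"
  have P: "sets P = sets C" "space P = space M" by (simp_all add: P_def C)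
  interpret P: finite_measure P
    unfolding P_def by (intro fin.finite_measure_distr MC) simp
  define Q where "Q g = distr M C (\<pi> g)" for g
  have Q: "finite_measure (Q g)" "sets (Q g) = sets P" "absolutely_continuous P (Q g)" for g
  proof -
    have \<pi>C: "\<pi> g \<in> M \<rightarrow>\<^sub>M C" by (intro MC) measurable
    show "finite_measure (Q g)" unfolding Q_def by (rule fin.finite_measure_distr[OF \<pi>C])
    show "sets (Q g) = sets P" by (simp add: Q_def P)
    show "absolutely_continuous P (Q g)"
      unfolding absolutely_continuous_def
    proof
      fix B assume "B \<in> null_sets P"
      then have B: "B \<in> sets C" "emeasure P B = 0" by (auto simp: P null_sets_def)
      have "B \<in> sets M" using B CM by auto
      moreover have "emeasure M B = 0"
        using B emeasure_distr[of "\<lambda>x. x" M C B] MC[of "\<lambda>x. x"] sets.sets_into_space[OF \<open>B \<in> sets M\<close>]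
        by (simp add: P_def Int_absorb2)
      ultimately have "emeasure (distr M M (\<pi> g)) B = 0"
        using absolutely_continuousD[OF nonsingular] by blast
      then show "B \<in> null_sets (Q g)"
        using B \<open>B \<in> sets M\<close> by (simp add: Q_def null_sets_def emeasure_distr \<pi>C)
    qed
  qed
  have Qm: "measure (Q g) B = measure M (\<pi> g -` B \<inter> space M)" if "B \<in> sets C" for g B
    unfolding Q_def using that MC[of "\<pi> g"] by (intro measure_distr) auto
  have gen: "sets P = sigma_sets (space P) (\<Union>n. A n)" by (simp add: P C)
  have A': "countable (\<Union>n. A n)" "(\<Union>n. A n) \<subseteq> sets P"
    using A(1) sigma_sets_superset_generator unfolding P C by simp_all
  obtain \<A> s where \<A>: "countable \<A>" "\<A> \<subseteq> sets P"
    and s: "\<And>Q e. \<lbrakk>finite_measure Q; sets Q = sets P; absolutely_continuous P Q; e > 0\<rbrakk>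
      \<Longrightarrow> \<exists>i::nat. \<forall>E\<in>sets P. \<bar>measure Q E - s i E\<bar> \<le> e"
    and norming: "\<And>Q Q' c. \<lbrakk>finite_measure Q; sets Q = sets P; absolutely_continuous P Q;
      finite_measure Q'; sets Q' = sets P; absolutely_continuous P Q';
      \<forall>E\<in>\<A>. \<bar>measure Q E - measure Q' E\<bar> \<le> c\<rbrakk> \<Longrightarrow> \<forall>E\<in>sets P. \<bar>measure Q E - measure Q' E\<bar> \<le> c"
    by (rule P.dominated_measures_separable[OF gen A']) (rule that)
  \<comment> \<open>Borel, since only the countable algebra is quantified over; on \<open>B i\<close> the translates differ by at most \<open>e\<close>.\<close>
  define B where "B i = {g. \<forall>E\<in>\<A>. \<bar>measure (Q g) E - s i E\<bar> \<le> e / 2}" for i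
  have "B i \<in> sets borel" for i
  proof -
    have "{g. \<bar>measure (Q g) E - s i E\<bar> \<le> e / 2} \<in> sets borel" if "E \<in> \<A>" for E
    proof -
      have "E \<in> sets C" "E \<in> sets M" using \<A>(2) P CM that by auto
      then have [measurable]: "(\<lambda>g. measure (Q g) E) \<in> borel_measurable borel"
        using measurable_measure_act by (simp add: Qm)
      have "{g \<in> space borel. \<bar>measure (Q g) E - s i E\<bar> \<le> e / 2} \<in> sets borel"
        by measurable
      then show ?thesis by simp
    qed
    then have "{g \<in> space borel. \<forall>E\<in>\<A>. g \<in> {g. \<bar>measure (Q g) E - s i E\<bar> \<le> e / 2}} \<in> sets borel"
      by (intro sets.sets_Collect_countable_All' \<A>(1)) simp
    then show ?thesis by (simp add: B_def)
  qed
  moreover have "(\<Union>i. B i) = UNIV"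
  proof -
    have "\<exists>i. g \<in> B i" for g
      using s[OF Q, of "e / 2" g] \<open>e > 0\<close> \<A>(2) unfolding B_def by (simp add: subset_eq) blast
    then show ?thesis by blast
  qed
  ultimately obtain i W where W: "open W" "0 \<in> W" "\<And>k. k \<in> W \<Longrightarrow> \<exists>h. h \<in> B i \<and> h + k \<in> B i"
    using Pettis_countable_cover[OF locally_compact_group, of B] by blast
  obtain n where n: "N n \<subseteq> W"
    using eventually_happens'[OF sequentially_bot N(3)[OF W(1,2)]] by blast
  obtain h where h: "h \<in> B i" "h + k n \<in> B i" using W(3) kE(1) n by blast
  have "\<forall>E\<in>\<A>. \<bar>measure (Q (h + k n)) E - measure (Q h) E\<bar> \<le> e"
  proof
    fix E assume "E \<in> \<A>"
    then have "\<bar>measure (Q (h + k n)) E - s i E\<bar> \<le> e / 2" "\<bar>measure (Q h) E - s i E\<bar> \<le> e / 2"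
      using h by (auto simp: B_def)
    then show "\<bar>measure (Q (h + k n)) E - measure (Q h) E\<bar> \<le> e" by linarith
  qed
  then have "\<forall>E\<in>sets P. \<bar>measure (Q (h + k n)) E - measure (Q h) E\<bar> \<le> e"
    by (intro norming Q)
  then have "\<bar>measure (Q (h + k n)) (\<pi> (- h) -` E n \<inter> space M) -
    measure (Q h) (\<pi> (- h) -` E n \<inter> space M)\<bar> \<le> e"
    using transl by (simp add: P)
  moreover have "\<pi> (h + k n) -` (\<pi> (- h) -` E n \<inter> space M) \<inter> space M = \<pi> (k n) -` E n \<inter> space M"
    by (auto simp: act_add)
  moreover have "\<pi> h -` (\<pi> (- h) -` E n \<inter> space M) \<inter> space M = E n"
    using sets.sets_into_space[OF kE(2)[of n]] by auto
  ultimately show False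
    using kE(3)[of n] by (simp add: Qm transl)
qed

end

section \<open>Jointly measurable densities\<close>

text \<open>
  The bound is applied on the set where the difference is nonnegative and on its complement.
\<close>

lemma L1_le_twice_TV:
  fixes f f' :: "'x \<Rightarrow> real"
  assumes f: "integrable M f" "integrable M f'"
    and le: "\<And>E. E \<in> sets M \<Longrightarrow> \<bar>(LINT x|M. f x * indicator E x) - (LINT x|M. f' x * indicator E x)\<bar> \<le> c"
  shows "(LINT x|M. \<bar>f x - f' x\<bar>) \<le> 2 * c"
proof -
  have [measurable]: "f \<in> borel_measurable M" "f' \<in> borel_measurable M" using f by auto
  define E where "E = {x \<in> space M. f' x \<le> f x}"
  define E' where "E' = {x \<in> space M. f x < f' x}"
  have E: "E \<in> sets M" "E' \<in> sets M" unfolding E_def E'_def by measurable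
  note int = integrable_real_mult_indicator[OF E(1) f(1)] integrable_real_mult_indicator[OF E(1) f(2)]
    integrable_real_mult_indicator[OF E(2) f(1)] integrable_real_mult_indicator[OF E(2) f(2)]
  have "(LINT x|M. \<bar>f x - f' x\<bar>) = (LINT x|M. (f x * indicator E x - f' x * indicator E x) +
    (f' x * indicator E' x - f x * indicator E' x))"
    by (intro Bochner_Integration.integral_cong) (auto simp: E_def E'_def indicator_def)
  also have "\<dots> = ((LINT x|M. f x * indicator E x) - (LINT x|M. f' x * indicator E x)) +
    ((LINT x|M. f' x * indicator E' x) - (LINT x|M. f x * indicator E' x))"
    using int by simp
  also have "\<dots> \<le> 2 * c" using le[OF E(1)] le[OF E(2)] by linarith
  finally show ?thesis .
qed

lemma AE_tendsto_if_summable_L1: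
  fixes f :: "nat \<Rightarrow> 'x \<Rightarrow> real"
  assumes f: "\<And>n. integrable M (f n)" "integrable M f'"
    and le: "\<And>n. (LINT x|M. \<bar>f n x - f' x\<bar>) \<le> c n" and c: "summable c"
  shows "AE x in M. (\<lambda>n. f n x) \<longlonglongrightarrow> f' x"
proof -
  have [measurable]: "f n \<in> borel_measurable M" "f' \<in> borel_measurable M" for n using f by auto
  have nn: "(\<integral>\<^sup>+x. ennreal \<bar>f n x - f' x\<bar> \<partial>M) \<le> ennreal (c n)" for n
    using f le[of n] by (subst nn_integral_eq_integral) (auto intro!: ennreal_leI)
  have c0: "0 \<le> c n" for n
    using order_trans[OF integral_nonneg_AE le[of n]] by simp
  have "(\<integral>\<^sup>+x. (\<Sum>n. ennreal \<bar>f n x - f' x\<bar>) \<partial>M) = (\<Sum>n. \<integral>\<^sup>+x. ennreal \<bar>f n x - f' x\<bar> \<partial>M)"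
    by (intro nn_integral_suminf) measurable
  also have "\<dots> \<le> (\<Sum>n. ennreal (c n))" by (intro suminf_le nn) auto
  also have "\<dots> = ennreal (suminf c)" using c c0 by (intro suminf_ennreal2)
  also have "\<dots> < \<infinity>" by simp
  finally have "AE x in M. (\<Sum>n. ennreal \<bar>f n x - f' x\<bar>) \<noteq> \<infinity>"
    by (intro nn_integral_PInf_AE) (auto simp: less_top)
  then show ?thesis
  proof eventually_elim
    fix x assume "(\<Sum>n. ennreal \<bar>f n x - f' x\<bar>) \<noteq> \<infinity>"
    then have "summable (\<lambda>n. \<bar>f n x - f' x\<bar>)"
      by (intro summable_suminf_not_top) simp_all
    then have "(\<lambda>n. f n x - f' x) \<longlonglongrightarrow> 0"
      using summable_LIMSEQ_zero tendsto_rabs_zero_iff by blast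
    then show "(\<lambda>n. f n x) \<longlonglongrightarrow> f' x" by (simp add: LIM_zero_iff)
  qed
qed

context nonsingular_action
begin

lemma act_vimage_add:
  "\<pi> (h + k) -` E \<inter> space M = \<pi> k -` (\<pi> h -` E \<inter> space M) \<inter> space M"
  by (auto simp: act_add)

text \<open>
  By continuity in total variation, the density at \<open>g\<close> is \<open>2 * (1/2)^n\<close>-close in \<open>L\<^sup>1\<close> to the density at a
  point \<open>h n j\<close> of a fixed countable set, and \<open>j\<close> can be chosen as a Borel function of \<open>g\<close>.
  These approximations are jointly measurable, and their rate of convergence makes them converge
  almost everywhere for every \<open>g\<close>.
\<close>

lemma jointly_measurable_density_finite:
  assumes "finite_measure M"
  shows "\<exists>J. J \<in> borel_measurable (borel \<Otimes>\<^sub>M M) \<and>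
    (\<forall>g. density M (\<lambda>x. ennreal (J (g, x))) = distr M M (\<pi> g))"
proof -
  interpret fin: finite_measure M by fact
  define Q where "Q g = distr M M (\<pi> g)" for g
  have Q: "finite_measure (Q g)" "sets (Q g) = sets M" "absolutely_continuous M (Q g)"
    "E \<in> sets M \<Longrightarrow> measure (Q g) E = measure M (\<pi> g -` E \<inter> space M)" for g E
    unfolding Q_def using nonsingular[of g]
    by (auto intro!: fin.finite_measure_distr measure_distr)
  have "\<forall>g. \<exists>D. integrable M D \<and> (\<forall>x. 0 \<le> D x) \<and>
    (\<forall>E\<in>sets M. measure (Q g) E = (LINT x|M. D x * indicator E x))"
  proof
    fix g
    show "\<exists>D. integrable M D \<and> (\<forall>x. 0 \<le> D x) \<and>
      (\<forall>E\<in>sets M. measure (Q g) E = (LINT x|M. D x * indicator E x))"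
      by (rule fin.dominated_real_density[OF Q(1-3), of g]) blast
  qed
  from choice[OF this] obtain D where "\<forall>g. integrable M (D g) \<and> (\<forall>x. 0 \<le> D g x) \<and>
    (\<forall>E\<in>sets M. measure (Q g) E = (LINT x|M. D g x * indicator E x))" ..
  then have D: "integrable M (D g)" "0 \<le> D g x"
    "E \<in> sets M \<Longrightarrow> measure (Q g) E = (LINT x|M. D g x * indicator E x)" for g x E
    by simp_all
  have D_measurable [measurable]: "D g \<in> borel_measurable M" for g using D(1) by auto
  have density_D: "density M (\<lambda>x. ennreal (D g x)) = distr M M (\<pi> g)" for g
  proof (rule measure_eqI)
    fix E assume "E \<in> sets (density M (\<lambda>x. ennreal (D g x)))"
    then have E: "E \<in> sets M" by simp
    interpret Qg: finite_measure "Q g" by (rule Q)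
    have "emeasure (density M (\<lambda>x. ennreal (D g x))) E = (\<integral>\<^sup>+x. ennreal (D g x * indicator E x) \<partial>M)"
      using E by (subst emeasure_density) (auto intro!: nn_integral_cong simp: indicator_def)
    also have "\<dots> = ennreal (measure (Q g) E)"
      unfolding D(3)[OF E] using E D(1,2)
      by (intro nn_integral_eq_integral integrable_real_mult_indicator) auto
    finally show "emeasure (density M (\<lambda>x. ennreal (D g x))) E = emeasure (distr M M (\<pi> g)) E"
      by (simp add: Qg.emeasure_eq_measure[symmetric] Q_def[symmetric])
  qed simp
  have "\<forall>n. \<exists>W. open W \<and> 0 \<in> W \<and>
    (\<forall>k\<in>W. \<forall>E\<in>sets M. \<bar>measure M (\<pi> k -` E \<inter> space M) - measure M E\<bar> \<le> (1/2)^n)"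
  proof
    fix n :: nat
    have "(1/2 :: real)^n > 0" by simp
    from translates_TV_continuous[OF assms this]
    show "\<exists>W. open W \<and> 0 \<in> W \<and>
      (\<forall>k\<in>W. \<forall>E\<in>sets M. \<bar>measure M (\<pi> k -` E \<inter> space M) - measure M E\<bar> \<le> (1/2)^n)" .
  qed
  from choice[OF this] obtain W where "\<forall>n. open (W n) \<and> 0 \<in> W n \<and>
    (\<forall>k\<in>W n. \<forall>E\<in>sets M. \<bar>measure M (\<pi> k -` E \<inter> space M) - measure M E\<bar> \<le> (1/2)^n)" ..
  then have W: "open (W n)" "0 \<in> W n" "k \<in> W n \<Longrightarrow> E \<in> sets M \<Longrightarrow>
    \<bar>measure M (\<pi> k -` E \<inter> space M) - measure M E\<bar> \<le> (1/2)^n" for n k E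
    by simp_all
  have L1: "(LINT x|M. \<bar>D h x - D g x\<bar>) \<le> 2 * (1/2)^n" if "- h + g \<in> W n" for h g n
  proof (rule L1_le_twice_TV[OF D(1) D(1)])
    fix E assume E: "E \<in> sets M"
    have "g = h + (- h + g)" by (simp add: add.assoc[symmetric])
    then have Qg: "measure (Q g) E = measure M (\<pi> (- h + g) -` (\<pi> h -` E \<inter> space M) \<inter> space M)"
      using Q(4)[OF E, of g] by (simp only: act_vimage_add[of h "- h + g" E, symmetric])
    have "\<pi> h -` E \<inter> space M \<in> sets M" using E by (rule act_vimage_sets)
    then have "\<bar>measure (Q g) E - measure (Q h) E\<bar> \<le> (1/2)^n"
      unfolding Qg Q(4)[OF E, of h] by (rule W(3)[OF that])
    then show "\<bar>(LINT x|M. D h x * indicator E x) - (LINT x|M. D g x * indicator E x)\<bar> \<le> (1/2)^n"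
      unfolding D(3)[OF E, symmetric] by linarith
  qed
  have translate_open: "open {g. - h + g \<in> W n}" for h n
    by (intro open_Collect_mem[OF W(1)] continuous_intros)
  have "\<forall>n. \<exists>h :: nat \<Rightarrow> 'g. \<forall>g. \<exists>i. - h i + g \<in> W n"
  proof
    fix n
    obtain F where F: "F \<subseteq> range (\<lambda>h. {g. - h + g \<in> W n})" "countable F"
      "\<Union>F = \<Union>(range (\<lambda>h. {g. - h + g \<in> W n}))"
      by (rule Lindelof[of "range (\<lambda>h. {g. - h + g \<in> W n})"]) (use translate_open in auto)
    obtain C where C: "countable C" "F = (\<lambda>h. {g. - h + g \<in> W n}) ` C"
      using F(1,2) by (metis countable_subset_image)
    have cover: "\<exists>h\<in>C. - h + g \<in> W n" for g
    proof -
      have "g \<in> {g'. - g + g' \<in> W n}" using W(2) by simp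
      then have "g \<in> \<Union>F" unfolding F(3) by blast
      then show ?thesis unfolding C(2) by blast
    qed
    have "\<exists>i. - from_nat_into C i + g \<in> W n" for g
      using cover[of g] from_nat_into_surj[OF C(1)] by metis
    then show "\<exists>h :: nat \<Rightarrow> 'g. \<forall>g. \<exists>i. - h i + g \<in> W n" by blast
  qed
  from choice[OF this] obtain h :: "nat \<Rightarrow> nat \<Rightarrow> 'g" where h: "\<forall>n g. \<exists>i. - h n i + g \<in> W n" ..
  define i where "i n g = (LEAST i. - h n i + g \<in> W n)" for n g
  have i: "- h n (i n g) + g \<in> W n" for n g
  proof -
    have "\<exists>j. - h n j + g \<in> W n" using h by simp
    then show ?thesis unfolding i_def by (rule LeastI_ex)
  qed
  have i_measurable [measurable]: "i n \<in> borel \<rightarrow>\<^sub>M count_space UNIV" for n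
  proof -
    have "Measurable.pred borel (\<lambda>g. - h n j + g \<in> W n)" for j
      using translate_open[of "h n j" n] by (simp add: pred_def)
    then show ?thesis unfolding i_def by (intro measurable_Least)
  qed
  define J where "J y = lim (\<lambda>n. D (h n (i n (fst y))) (snd y))" for y
  have "J \<in> borel_measurable (borel \<Otimes>\<^sub>M M)"
  proof -
    have "(\<lambda>y. D (h n (i n (fst y))) (snd y)) \<in> borel_measurable (borel \<Otimes>\<^sub>M M)" for n
      by (rule measurable_compose_countable[where g = "\<lambda>y. i n (fst y)" and f = "\<lambda>j y. D (h n j) (snd y)"])
        measurable
    then show ?thesis unfolding J_def by measurable
  qed
  moreover have "density M (\<lambda>x. ennreal (J (g, x))) = distr M M (\<pi> g)" for g
  proof -
    have "AE x in M. (\<lambda>n. D (h n (i n g)) x) \<longlonglongrightarrow> D g x"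
    proof (rule AE_tendsto_if_summable_L1[OF D(1) D(1)])
      show "(LINT x|M. \<bar>D (h n (i n g)) x - D g x\<bar>) \<le> 2 * (1/2)^n" for n
        by (rule L1[OF i])
      show "summable (\<lambda>n. 2 * (1/2 :: real)^n)"
        by (intro summable_mult summable_geometric) simp
    qed
    then have AE: "AE x in M. J (g, x) = D g x"
      by eventually_elim (simp add: J_def limI)
    have "density M (\<lambda>x. ennreal (J (g, x))) = density M (\<lambda>x. ennreal (D g x))"
    proof (rule density_cong)
      have "(\<lambda>x. J (g, x)) \<in> borel_measurable M"
        using measurable_Pair2[OF \<open>J \<in> borel_measurable (borel \<Otimes>\<^sub>M M)\<close>] by simp
      then show "(\<lambda>x. ennreal (J (g, x))) \<in> borel_measurable M" by measurable
      show "AE x in M. ennreal (J (g, x)) = ennreal (D g x)" using AE by eventually_elim simp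
    qed measurable
    then show ?thesis by (simp add: density_D)
  qed
  ultimately show ?thesis by blast
qed

text \<open>
  The finite case is applied to a finite measure with strictly positive density \<open>h\<close>. Passing back to
  \<open>M\<close> changes the density by the coboundary factor \<open>h x / h (\<pi> (- g) x)\<close>.
\<close>

lemma jointly_measurable_density:
  "\<exists>J. J \<in> borel_measurable (borel \<Otimes>\<^sub>M M) \<and> (\<forall>g. density M (\<lambda>x. J (g, x)) = distr M M (\<pi> g))"
proof -
  obtain h where h [measurable]: "h \<in> borel_measurable M"
    and h_fin: "integral\<^sup>N M h \<noteq> \<infinity>" and h_pos: "\<And>x. x \<in> space M \<Longrightarrow> 0 < h x \<and> h x < \<infinity>"
    using Ex_finite_integrable_function by blast
  define N where "N = density M h"
  have N [simp]: "sets N = sets M" "space N = space M" by (simp_all add: N_def)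
  have meas [simp]: "measurable N K = measurable M K" "measurable K N = measurable K M" for K :: "'y measure"
    by (auto intro!: measurable_cong_sets)
  have meas' [simp]: "measurable N N = measurable M M"
    by (intro measurable_cong_sets) simp_all
  have pairN: "sets (borel \<Otimes>\<^sub>M N) = sets (borel \<Otimes>\<^sub>M M)"
    by (intro sets_pair_measure_cong) simp_all
  have "emeasure N (space N) \<noteq> \<infinity>"
    using h_fin by (simp add: N_def emeasure_density cong: nn_integral_cong)
  then have "finite_measure N" by (rule finite_measureI)
  have nullN: "null_sets N = null_sets M"
  proof -
    have "A \<in> null_sets N \<longleftrightarrow> A \<in> null_sets M" if A: "A \<in> sets M" for A
    proof -
      have "A \<in> null_sets N \<longleftrightarrow> (AE x in M. x \<in> A \<longrightarrow> h x = 0)"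
        unfolding N_def null_sets_density_iff[OF h] using A by simp
      also have "\<dots> \<longleftrightarrow> (AE x in M. x \<notin> A)"
      proof (intro AE_cong)
        fix x assume "x \<in> space M"
        then have "h x \<noteq> 0" using h_pos[of x] by (simp add: zero_less_iff_neq_zero)
        then show "(x \<in> A \<longrightarrow> h x = 0) = (x \<notin> A)" by simp
      qed
      also have "\<dots> \<longleftrightarrow> A \<in> null_sets M" using A by (rule AE_iff_null_sets[symmetric])
      finally show ?thesis .
    qed
    moreover have "A \<in> sets M" if "A \<in> null_sets N" for A
      using that null_setsD2[of A N] by simp
    moreover have "A \<in> sets M" if "A \<in> null_sets M" for A
      using that by (rule null_setsD2)
    ultimately show ?thesis by (intro set_eqI) metis
  qed
  interpret N: nonsingular_action N \<pi>
  proof (intro nonsingular_action.intro nonsingular_action_axioms.intro)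
    show "sigma_finite_measure N"
      using \<open>finite_measure N\<close> by (simp add: finite_measure_def)
    show "(\<lambda>(g, x). \<pi> g x) \<in> borel \<Otimes>\<^sub>M N \<rightarrow>\<^sub>M N"
      by (subst measurable_cong_sets[OF pairN N(1)]) (rule measurable_act)
    show "absolutely_continuous N (distr N N (\<pi> g))" for g
      unfolding absolutely_continuous_def
    proof
      fix A assume "A \<in> null_sets N"
      then have A: "A \<in> null_sets M" by (simp add: nullN)
      then have "A \<in> null_sets (distr M M (\<pi> g))"
        using nonsingular[of g] unfolding absolutely_continuous_def by blast
      then have "\<pi> g -` A \<inter> space M \<in> null_sets M"
        by (auto simp: null_sets_def emeasure_distr)
      then have "\<pi> g -` A \<inter> space M \<in> null_sets N" by (simp add: nullN)
      then show "A \<in> null_sets (distr N N (\<pi> g))"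
        using A by (auto simp: null_sets_def emeasure_distr)
    qed
  qed (use locally_compact_group act_add act_zero in simp_all)
  obtain J where J: "J \<in> borel_measurable (borel \<Otimes>\<^sub>M N)"
    "\<And>g. density N (\<lambda>x. ennreal (J (g, x))) = distr N N (\<pi> g)"
    using N.jointly_measurable_density_finite[OF \<open>finite_measure N\<close>] by blast
  have Jm [measurable]: "J \<in> borel_measurable (borel \<Otimes>\<^sub>M M)"
    using J(1) measurable_cong_sets[OF pairN refl] by blast
  define J' where "J' y = h (snd y) * (ennreal (J y) * inverse (h (\<pi> (- fst y) (snd y))))" for y
  have "J' \<in> borel_measurable (borel \<Otimes>\<^sub>M M)" unfolding J'_def by measurable
  moreover have "density M (\<lambda>x. J' (g, x)) = distr M M (\<pi> g)" for g
  proof -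
    have Jg [measurable]: "(\<lambda>x. J (g, x)) \<in> borel_measurable M"
      using measurable_Pair2[OF Jm] by simp
    have inv_h: "density N (\<lambda>x. inverse (h x)) = M"
    proof -
      have "density N (\<lambda>x. inverse (h x)) = density M (\<lambda>x. h x * inverse (h x))"
        unfolding N_def by (intro density_density_eq) measurable
      also have "\<dots> = density M (\<lambda>x. 1)"
      proof (intro density_cong AE_I2)
        fix x assume "x \<in> space M"
        then have "h x \<noteq> 0" "h x \<noteq> top" using h_pos[of x] by (auto simp: zero_less_iff_neq_zero)
        then show "h x * inverse (h x) = 1"
          using ennreal_divide_self[of "h x"] by (simp add: divide_ennreal_def top.not_eq_extremum)
      qed measurable
      finally show ?thesis by (simp add: density_1)
    qed
    have "density M (\<lambda>x. J' (g, x)) = density N (\<lambda>x. ennreal (J (g, x)) * inverse (h (\<pi> (- g) x)))"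
      unfolding N_def J'_def fst_conv snd_conv by (intro density_density_eq[symmetric]) measurable
    also have "\<dots> = density (density N (\<lambda>x. ennreal (J (g, x)))) (\<lambda>x. inverse (h (\<pi> (- g) x)))"
      by (intro density_density_eq[symmetric]) simp_all
    also have "\<dots> = density (distr N N (\<pi> g)) (\<lambda>x. inverse (h (\<pi> (- g) x)))"
      by (simp add: J(2))
    also have "\<dots> = distr (density N (\<lambda>x. inverse (h (\<pi> (- g) (\<pi> g x))))) N (\<pi> g)"
      by (intro density_distr) simp_all
    also have "density N (\<lambda>x. inverse (h (\<pi> (- g) (\<pi> g x)))) = M"
      unfolding inv_h[symmetric] by (intro density_cong) auto
    also have "distr M N (\<pi> g) = distr M M (\<pi> g)"
      by (intro distr_cong) simp_all
    finally show ?thesis .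
  qed
  ultimately show ?thesis by blast
qed

lemma sigma_finite_distr_act: "sigma_finite_measure (distr M M (\<pi> g))"
proof (rule sigma_finite_measure_distr)
  have "distr (distr M M (\<pi> g)) M (\<pi> (- g)) = distr M M (\<lambda>x. \<pi> (- g) (\<pi> g x))"
    by (subst distr_distr) (simp_all add: comp_def)
  also have "\<dots> = distr M M (\<lambda>x. x)" by (intro distr_cong) simp_all
  also have "\<dots> = M" by simp
  finally show "sigma_finite_measure (distr (distr M M (\<pi> g)) M (\<pi> (- g)))"
    using sigma_finite_measure_axioms by simp
qed simp

lemma translated_measure_eq_distr: "translated_measure \<pi> M g = distr M M (\<pi> (- g))"
proof -
  have "\<pi> g ` E = \<pi> (- g) -` E \<inter> space M" if "E \<in> sets M" for E
  proof -
    have E: "E \<subseteq> space M" using that by (rule sets.sets_into_space)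
    show ?thesis
    proof
      show "\<pi> g ` E \<subseteq> \<pi> (- g) -` E \<inter> space M" using E by auto
      show "\<pi> (- g) -` E \<inter> space M \<subseteq> \<pi> g ` E" by (auto intro!: image_eqI[where x = "\<pi> (- g) _"])
    qed
  qed
  then show ?thesis
    unfolding translated_measure_def distr_def
    by (intro measure_of_eq) (simp_all add: sets.space_closed sets.sigma_sets_eq)
qed

text \<open>
  The translate of a sigma-finite measure is sigma-finite, so its derivative is almost everywhere finite
  and nothing is lost in passing from extended to real values.
\<close>

lemma density_translation_derivative:
  "density M (\<lambda>x. ennreal (translation_derivative \<pi> M (- g) x)) = distr M M (\<pi> g)"
proof -
  have "AE x in M. RN_deriv M (distr M M (\<pi> g)) x \<noteq> \<infinity>"
    by (intro RN_deriv_finite sigma_finite_distr_act nonsingular) simp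
  then have "AE x in M. ennreal (translation_derivative \<pi> M (- g) x) = RN_deriv M (distr M M (\<pi> g)) x"
    unfolding translation_derivative_def translated_measure_eq_distr
    by eventually_elim (simp add: less_top)
  then have "density M (\<lambda>x. ennreal (translation_derivative \<pi> M (- g) x)) =
    density M (RN_deriv M (distr M M (\<pi> g)))"
    unfolding translation_derivative_def by (intro density_cong) simp_all
  also have "\<dots> = distr M M (\<pi> g)"
    by (intro density_RN_deriv nonsingular) simp
  finally show ?thesis .
qed

end

section \<open>Measurable fields of vectors\<close>

text \<open>
  Reduces continuity of the complex inner product to that of the real one.
\<close>

lemma cinner_eq_Complex: "cinner x y = Complex (inner x y) (inner (scaleC (- \<i>) x) y)"
proof (rule complex_eqI)
  have "inner (scaleC (- \<i>) x) y = Re (- \<i> * cinner x y)"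
    by (simp only: Re_cinner[symmetric] cinner_scaleC_left)
  then show "Im (cinner x y) = Im (Complex (inner x y) (inner (scaleC (- \<i>) x) y))" by simp
qed (simp add: Re_cinner)

lemma cinner_scaleC_right: "cinner x (scaleC c y) = cnj c * cinner x y"
  by (metis cinner_commute cinner_scaleC_left complex_cnj_mult)

lemma norm_scaleC: "norm (scaleC c x) = cmod c * norm x"
proof -
  have "inner (scaleC c x) (scaleC c x) = Re (c * (cnj c * cinner x x))"
    unfolding Re_cinner[symmetric] cinner_scaleC_left cinner_scaleC_right by (simp add: ac_simps)
  also have "\<dots> = (cmod c)\<^sup>2 * inner x x"
    by (simp add: mult.assoc[symmetric] complex_norm_square[symmetric] Re_cinner del: of_real_power)
  finally have "(norm (scaleC c x))\<^sup>2 = (cmod c * norm x)\<^sup>2"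
    by (simp add: power2_norm_eq_inner power_mult_distrib)
  then show ?thesis by (simp add: power2_eq_iff_nonneg)
qed

lemma scaleC_of_real_scaleR: "scaleC c (scaleR r x) = scaleR r (scaleC c x)"
  by (simp add: scaleC_of_real[symmetric] scaleC_scaleC mult.commute)

lemma bounded_linear_scaleC: "bounded_linear (scaleC c)"
  by (rule bounded_linear_intro[of _ "cmod c"])
    (simp_all add: scaleC_add_right scaleC_of_real_scaleR norm_scaleC mult.commute)

lemma cinner_self: "cinner x x = complex_of_real ((norm x)\<^sup>2)"
proof (rule complex_eqI)
  show "Im (cinner x x) = Im (complex_of_real ((norm x)\<^sup>2))"
    using arg_cong[OF cinner_commute[of x x], of Im] by simp
qed (simp add: Re_cinner power2_norm_eq_inner)

lemma tendsto_cinner [tendsto_intros]: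
  assumes "(f \<longlongrightarrow> a) F" "(k \<longlongrightarrow> b) F"
  shows "((\<lambda>x. cinner (f x) (k x)) \<longlongrightarrow> cinner a b) F"
  unfolding cinner_eq_Complex
  by (intro tendsto_Complex tendsto_inner assms bounded_linear.tendsto[OF bounded_linear_scaleC])

lemma continuous_on_cinner [continuous_intros]:
  "continuous_on S f \<Longrightarrow> continuous_on S k \<Longrightarrow> continuous_on S (\<lambda>x. cinner (f x) (k x))"
  unfolding continuous_on_def by (auto intro: tendsto_cinner)

lemma cinner_zero_left [simp]: "cinner 0 y = 0"
  using cinner_scaleC_left[of 0 0 y] scaleC_of_real[of 0 0] by simp

lemma cinner_scaleR_left: "cinner (scaleR r x) y = complex_of_real r * cinner x y"
  by (simp add: scaleC_of_real[symmetric] cinner_scaleC_left)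

lemma borel_measurable_completion_AE:
  fixes f g :: "'a \<Rightarrow> 'b::topological_space"
  assumes g: "g \<in> borel_measurable M" and eq: "AE x in M. f x = g x"
  shows "f \<in> borel_measurable (completion M)"
proof (rule measurableI)
  fix A :: "'b set" assume "A \<in> sets borel"
  then have "g -` A \<inter> space M \<in> sets M" using g by (rule measurable_sets[rotated])
  then have A: "g -` A \<inter> space M \<in> sets (completion M)" by simp
  have "AE x in completion M. f x = g x" using eq by (rule AE_completion)
  then have "AE x in completion M. x \<in> g -` A \<inter> space M \<longleftrightarrow> x \<in> f -` A \<inter> space (completion M)"
    by eventually_elim simp
  then show "f -` A \<inter> space (completion M) \<in> sets (completion M)"
    by (rule completion.in_sets_AE[OF _ A]) simp
qed simp

locale hilbert_bundle =
  fixes M :: "'x measure" and \<nu> :: "'x \<Rightarrow> enat" and H :: "enat \<Rightarrow> 'h::complex_inner set"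
  assumes fibre: "separable_hilbert_space (H m) m"
    and dimension_measurable [measurable]: "\<nu> \<in> M \<rightarrow>\<^sub>M count_space UNIV"
begin

lemma csubspace_fibre: "csubspace (H m)"
  using fibre[of m] by (simp add: separable_hilbert_space_def)

lemma zero_in_fibre [simp]: "0 \<in> H m"
  using csubspace_fibre by (rule complex_vector.subspace_0)

lemma add_in_fibre: "u \<in> H m \<Longrightarrow> v \<in> H m \<Longrightarrow> u + v \<in> H m"
  using csubspace_fibre by (rule complex_vector.subspace_add)

lemma diff_in_fibre: "u \<in> H m \<Longrightarrow> v \<in> H m \<Longrightarrow> u - v \<in> H m"
  using csubspace_fibre by (rule complex_vector.subspace_diff)

lemma scaleC_in_fibre: "u \<in> H m \<Longrightarrow> scaleC c u \<in> H m"
  using csubspace_fibre by (rule complex_vector.subspace_scale)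

lemma scaleR_in_fibre: "u \<in> H m \<Longrightarrow> scaleR r u \<in> H m"
  unfolding scaleC_of_real[symmetric] by (rule scaleC_in_fibre)

definition dense :: "enat \<Rightarrow> nat \<Rightarrow> 'h" where
  "dense m = (SOME d. (\<forall>i. d i \<in> H m) \<and> (\<forall>v\<in>H m. \<forall>e>0. \<exists>i. norm (v - d i) < e))"

lemma
  shows dense_in_fibre [simp]: "dense m i \<in> H m"
    and dense_approx: "v \<in> H m \<Longrightarrow> e > 0 \<Longrightarrow> \<exists>i. norm (v - dense m i) < e"
proof -
  obtain D where D: "countable D" "D \<subseteq> H m" "H m \<subseteq> closure D"
    using fibre[of m] by (auto simp: separable_hilbert_space_def)
  have ex: "\<exists>u\<in>D. norm (v - u) < e" if "v \<in> H m" "e > 0" for v e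
    using that D(3) closure_approachable[of v D] by (auto simp: dist_norm norm_minus_commute)
  then have "D \<noteq> {}" using zero_in_fibre[of m] zero_less_one by blast
  have "\<exists>d. (\<forall>i::nat. d i \<in> H m) \<and> (\<forall>v\<in>H m. \<forall>e>0. \<exists>i. norm (v - d i) < e)"
  proof (intro exI[of _ "from_nat_into D"] conjI allI ballI impI)
    show "from_nat_into D i \<in> H m" for i using from_nat_into[OF \<open>D \<noteq> {}\<close>] D(2) by blast
    fix v and e :: real assume "v \<in> H m" "e > 0"
    then obtain u where u: "u \<in> D" "norm (v - u) < e" using ex by blast
    then show "\<exists>i. norm (v - from_nat_into D i) < e"
      using from_nat_into_surj[OF D(1) u(1)] by metis
  qed
  from someI_ex[OF this] show "dense m i \<in> H m" "v \<in> H m \<Longrightarrow> e > 0 \<Longrightarrow> \<exists>i. norm (v - dense m i) < e"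
    unfolding dense_def by simp_all
qed

lemma dense_limit:
  assumes "v \<in> H m"
  obtains i where "(\<lambda>n. dense m (i n)) \<longlonglongrightarrow> v"
proof -
  have "\<forall>n. \<exists>i. norm (v - dense m i) < inverse (Suc n)"
    using dense_approx[OF assms] by simp
  from choice[OF this] obtain i where i: "\<forall>n. norm (v - dense m (i n)) < inverse (Suc n)" ..
  have "(\<lambda>n. norm (dense m (i n) - v)) \<longlonglongrightarrow> 0"
    by (rule tendsto_sandwich[OF _ _ tendsto_const LIMSEQ_inverse_real_of_nat])
      (use i in \<open>auto simp: norm_minus_commute intro!: always_eventually less_imp_le\<close>)
  then have "(\<lambda>n. dense m (i n)) \<longlonglongrightarrow> v"
    by (simp add: tendsto_norm_zero_iff LIM_zero_iff)
  then show ?thesis by (rule that)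
qed

lemma norm_le_dense:
  assumes w: "w \<in> H m" and "r \<ge> 0" and le: "\<And>i. inner w (dense m i) \<le> r * norm (dense m i)"
  shows "norm w \<le> r"
proof -
  obtain i where i: "(\<lambda>n. dense m (i n)) \<longlonglongrightarrow> w" by (rule dense_limit[OF w])
  have "inner w w \<le> r * norm w"
    using tendsto_inner[OF tendsto_const i, of w] tendsto_mult[OF tendsto_const tendsto_norm[OF i], of r]
    by (rule LIMSEQ_le) (use le in blast)
  then have "norm w * norm w \<le> r * norm w" by (simp add: norm_eq_sqrt_inner)
  then show ?thesis using \<open>r \<ge> 0\<close>
    by (cases "norm w = 0") (auto simp: mult_le_cancel_right)
qed

text \<open>
  The strict version of a measurable field: values in the right fibre everywhere, and measurability
  with respect to \<open>M\<close> rather than its completion. Extending coefficients by 0 off the level sets keeps all functions on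
  one measurable space, so that they can be composed with the action, which preserves level sets
  only up to null sets.
\<close>

definition measurable_field :: "('x \<Rightarrow> 'h) \<Rightarrow> bool" where
  "measurable_field f \<longleftrightarrow> (\<forall>x\<in>space M. f x \<in> H (\<nu> x)) \<and>
    (\<forall>m. \<forall>h\<in>H m. (\<lambda>x. if \<nu> x = m then cinner (f x) h else 0) \<in> borel_measurable M)"

lemma measurable_field_in_fibre: "measurable_field f \<Longrightarrow> x \<in> space M \<Longrightarrow> f x \<in> H (\<nu> x)"
  by (simp add: measurable_field_def)

lemma measurable_field_coefficient:
  "measurable_field f \<Longrightarrow> h \<in> H m \<Longrightarrow> (\<lambda>x. if \<nu> x = m then cinner (f x) h else 0) \<in> borel_measurable M"
  by (simp add: measurable_field_def)

text \<open>
  The norm is a supremum of real inner products with countably many normalized vectors.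
\<close>

lemma measurable_field_norm_diff:
  assumes f: "measurable_field f" and u: "u \<in> H m"
  shows "(\<lambda>x. if \<nu> x = m then norm (f x - u) else 0) \<in> borel_measurable M"
  unfolding borel_measurable_iff_le
proof
  fix a :: real
  let ?S = "{x \<in> space M. (if \<nu> x = m then norm (f x - u) else 0) \<le> a}"
  define c where "c i x = (if \<nu> x = m then cinner (f x) (dense m i) else 0)" for i x
  have [measurable]: "c i \<in> borel_measurable M" for i
    unfolding c_def by (rule measurable_field_coefficient[OF f dense_in_fibre])
  define g where "g i x = Re (c i x) - (if \<nu> x = m then inner u (dense m i) else 0)" for i x
  have [measurable]: "g i \<in> borel_measurable M" for i
    unfolding g_def by measurable
  have g: "g i x = (if \<nu> x = m then inner (f x - u) (dense m i) else 0)" for i x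
    by (simp add: g_def c_def Re_cinner inner_diff_left)
  show "?S \<in> sets M"
  proof (cases "a \<ge> 0")
    case True
    have "?S = {x \<in> space M. \<forall>i. g i x \<le> a * norm (dense m i)}"
    proof (intro Collect_cong conj_cong refl)
      fix x assume x: "x \<in> space M"
      show "((if \<nu> x = m then norm (f x - u) else 0) \<le> a) \<longleftrightarrow> (\<forall>i. g i x \<le> a * norm (dense m i))"
      proof (cases "\<nu> x = m")
        case m: True
        have w: "f x - u \<in> H m" using measurable_field_in_fibre[OF f x] u m by (auto intro: diff_in_fibre)
        have "inner (f x - u) (dense m i) \<le> a * norm (dense m i)" if "norm (f x - u) \<le> a" for i
          using norm_cauchy_schwarz[of "f x - u" "dense m i"] mult_right_mono[OF that norm_ge_zero[of "dense m i"]]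
          by linarith
        then show ?thesis using norm_le_dense[OF w True] m by (auto simp: g)
      qed (use True in \<open>simp add: g\<close>)
    qed
    also have "\<dots> \<in> sets M" by measurable
    finally show ?thesis .
  next
    case False
    then have "?S = {}" by (auto dest: order_trans[OF norm_ge_zero] split: if_splits)
    then show ?thesis by (simp only: sets.empty_sets)
  qed
qed

text \<open>
  The type of \<open>f y\<close> is an inner product space that need not be second countable, so composition
  with Borel functions is not available. Instead \<open>f y\<close> is replaced by the first vector of the dense sequence that is
  \<open>1/(n+1)\<close>-close to it; this is a measurable choice among countably many constants, and continuity
  of \<open>\<Phi> y\<close> allows the limit to be taken.
\<close>

lemma borel_measurable_substitute:
  fixes \<Phi> :: "'y \<Rightarrow> 'h \<Rightarrow> complex"
  assumes \<Phi>: "\<And>u. u \<in> H m \<Longrightarrow> (\<lambda>y. if P y then \<Phi> y u else 0) \<in> borel_measurable Y"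
    and cont: "\<And>y. y \<in> space Y \<Longrightarrow> P y \<Longrightarrow> continuous_on (H m) (\<Phi> y)"
    and f: "\<And>y. y \<in> space Y \<Longrightarrow> P y \<Longrightarrow> f y \<in> H m"
    and nf: "\<And>u. u \<in> H m \<Longrightarrow> (\<lambda>y. if P y then norm (f y - u) else 0) \<in> borel_measurable Y"
  shows "(\<lambda>y. if P y then \<Phi> y (f y) else 0) \<in> borel_measurable Y"
proof -
  define idx where "idx n y = (LEAST i. (if P y then norm (f y - dense m i) else 0) < inverse (Suc n))" for n y
  have idx_measurable: "idx n \<in> Y \<rightarrow>\<^sub>M count_space UNIV" for n
  proof -
    have [measurable]: "(\<lambda>y. if P y then norm (f y - dense m i) else 0) \<in> borel_measurable Y" for i
      by (rule nf) simp
    show ?thesis unfolding idx_def by (intro measurable_Least) measurable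
  qed
  show ?thesis
  proof (rule borel_measurable_LIMSEQ_metric)
    show "(\<lambda>y. if P y then \<Phi> y (dense m (idx n y)) else 0) \<in> borel_measurable Y" for n
      by (rule measurable_compose_countable[OF \<Phi> idx_measurable]) simp
    fix y assume y: "y \<in> space Y"
    show "(\<lambda>n. if P y then \<Phi> y (dense m (idx n y)) else 0) \<longlonglongrightarrow> (if P y then \<Phi> y (f y) else 0)"
    proof (cases "P y")
      case True
      have "norm (f y - dense m (idx n y)) < inverse (Suc n)" for n
      proof -
        have "\<exists>i. norm (f y - dense m i) < inverse (Suc n)"
          using dense_approx[OF f[OF y True]] by simp
        from LeastI_ex[OF this] show ?thesis using True by (simp add: idx_def)
      qed
      then have "(\<lambda>n. norm (dense m (idx n y) - f y)) \<longlonglongrightarrow> 0"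
        by (intro tendsto_sandwich[OF _ _ tendsto_const LIMSEQ_inverse_real_of_nat])
          (auto simp: norm_minus_commute intro!: always_eventually less_imp_le)
      then have "(\<lambda>n. dense m (idx n y)) \<longlonglongrightarrow> f y"
        by (simp add: tendsto_norm_zero_iff LIM_zero_iff)
      then have "(\<lambda>n. \<Phi> y (dense m (idx n y))) \<longlonglongrightarrow> \<Phi> y (f y)"
        by (rule continuous_on_tendsto_compose[OF cont[OF y True] _ f[OF y True]]) simp
      then show ?thesis using True by simp
    qed simp
  qed
qed

lemma borel_measurable_levels:
  fixes F :: "'y \<Rightarrow> complex"
  assumes "\<And>m. (\<lambda>y. if \<nu> (p y) = m then F y else 0) \<in> borel_measurable Y" and "p \<in> Y \<rightarrow>\<^sub>M M"
  shows "F \<in> borel_measurable Y"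
proof -
  have "(\<lambda>y. if \<nu> (p y) = \<nu> (p y) then F y else 0) \<in> borel_measurable Y"
    by (rule measurable_compose_countable[OF assms(1) measurable_compose[OF assms(2) dimension_measurable]])
  then show ?thesis by simp
qed

lemma measurable_field_cinner:
  assumes f: "measurable_field f" and k: "measurable_field k"
  shows "(\<lambda>x. cinner (f x) (k x)) \<in> borel_measurable M"
proof (rule borel_measurable_levels[where p = "\<lambda>x. x"])
  fix m
  show "(\<lambda>x. if \<nu> x = m then cinner (f x) (k x) else 0) \<in> borel_measurable M"
    by (rule borel_measurable_substitute[where m = m])
      (auto intro!: measurable_field_coefficient[OF f] measurable_field_norm_diff[OF k]
        continuous_intros dest: measurable_field_in_fibre[OF k])
qed simp

lemma measurable_field_norm:
  assumes f: "measurable_field f"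
  shows "(\<lambda>x. norm (f x)) \<in> borel_measurable M"
proof -
  have [measurable]: "(\<lambda>x. cinner (f x) (f x)) \<in> borel_measurable M"
    by (rule measurable_field_cinner[OF f f])
  have "(\<lambda>x. sqrt (Re (cinner (f x) (f x)))) \<in> borel_measurable M" by measurable
  then show ?thesis by (simp add: Re_cinner norm_eq_sqrt_inner)
qed

lemma measurable_field_add:
  assumes "measurable_field f" "measurable_field k"
  shows "measurable_field (\<lambda>x. f x + k x)"
proof -
  have "(\<lambda>x. if \<nu> x = m then cinner (f x + k x) h else 0) \<in> borel_measurable M" if "h \<in> H m" for m h
  proof -
    have "(\<lambda>x. (if \<nu> x = m then cinner (f x) h else 0) + (if \<nu> x = m then cinner (k x) h else 0)) \<in> borel_measurable M"
      by (intro borel_measurable_add measurable_field_coefficient assms that)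
    then show ?thesis by (rule back_subst[where P = "\<lambda>f. f \<in> _"]) (auto simp: cinner_add_left)
  qed
  then show ?thesis
    using assms by (simp add: measurable_field_def add_in_fibre)
qed

lemma measurable_field_scaleC:
  assumes "measurable_field f" and [measurable]: "c \<in> borel_measurable M"
  shows "measurable_field (\<lambda>x. scaleC (c x) (f x))"
proof -
  have "(\<lambda>x. if \<nu> x = m then cinner (scaleC (c x) (f x)) h else 0) \<in> borel_measurable M" if "h \<in> H m" for m h
  proof -
    have "(\<lambda>x. c x * (if \<nu> x = m then cinner (f x) h else 0)) \<in> borel_measurable M"
      by (intro borel_measurable_times measurable_field_coefficient assms that)
    then show ?thesis by (rule back_subst[where P = "\<lambda>f. f \<in> _"]) (auto simp: cinner_scaleC_left)
  qed
  then show ?thesis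
    using assms by (simp add: measurable_field_def scaleC_in_fibre)
qed

abbreviation "L2 \<equiv> square_integrable_fields M \<nu> H"

lemma level_set_restrict_completion:
  "(\<lambda>x. cinner (f x) h) \<in> borel_measurable (restrict_space (completion M) (level_set M \<nu> m)) \<longleftrightarrow>
    (\<lambda>x. if \<nu> x = m then cinner (f x) h else 0) \<in> borel_measurable (completion M)"
proof -
  have "level_set M \<nu> m \<in> sets M" unfolding level_set_def by measurable
  then have "level_set M \<nu> m \<inter> space (completion M) \<in> sets (completion M)" by auto
  then have "(\<lambda>x. cinner (f x) h) \<in> borel_measurable (restrict_space (completion M) (level_set M \<nu> m)) \<longleftrightarrow>
    (\<lambda>x. if x \<in> level_set M \<nu> m then cinner (f x) h else 0) \<in> borel_measurable (completion M)"
    by (rule measurable_restrict_space_iff) simp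
  also have "\<dots> \<longleftrightarrow> (\<lambda>x. if \<nu> x = m then cinner (f x) h else 0) \<in> borel_measurable (completion M)"
    by (intro measurable_cong) (simp add: level_set_def)
  finally show ?thesis .
qed

text \<open>
  Each of the countably many coefficients along the dense sequences agrees with an \<open>M\<close>-measurable function off a null
  set. Replacing \<open>f\<close> by 0 on the union of these null sets makes all of them measurable at
  once, and the other coefficients are limits.
\<close>

lemma square_integrable_field_regularization:
  assumes f: "f \<in> L2"
  obtains f' where "measurable_field f'" "AE x in M. f x = f' x"
proof -
  define c where "c m i x = (if \<nu> x = m then cinner (f x) (dense m i) else 0)" for m i x
  have ex: "\<exists>g. g \<in> borel_measurable M \<and> (AE x in M. c m i x = g x)" for m i
  proof -
    have [measurable]: "c m i \<in> borel_measurable (completion M)"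
      using f unfolding square_integrable_fields_def level_set_restrict_completion c_def by simp
    have "(\<lambda>x. Re (c m i x)) \<in> borel_measurable (completion M)"
      "(\<lambda>x. Im (c m i x)) \<in> borel_measurable (completion M)"
      by measurable
    then obtain a b where [measurable]: "a \<in> borel_measurable M" "b \<in> borel_measurable M"
      and ab: "AE x in M. Re (c m i x) = a x" "AE x in M. Im (c m i x) = b x"
      by (elim completion_ex_borel_measurable_real[THEN bexE])
    have "AE x in M. c m i x = Complex (a x) (b x)"
      using ab by eventually_elim (auto intro: complex_eqI)
    moreover have "(\<lambda>x. Complex (a x) (b x)) \<in> borel_measurable M"
      by (simp add: borel_measurable_complex_iff)
    ultimately show ?thesis by (intro exI conjI)
  qed
  have "\<forall>p. \<exists>g. g \<in> borel_measurable M \<and> (AE x in M. c (fst p) (snd p) x = g x)"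
    by (intro allI ex)
  from choice[OF this] obtain g
    where "\<forall>p. g p \<in> borel_measurable M \<and> (AE x in M. c (fst p) (snd p) x = g p x)" ..
  then have g: "g p \<in> borel_measurable M" "AE x in M. c (fst p) (snd p) x = g p x" for p
    by (cases p; simp)+
  have "AE x in M. \<forall>p. c (fst p) (snd p) x = g p x"
    unfolding AE_all_countable by (intro allI g(2))
  moreover have "AE x in M. f x \<in> H (\<nu> x)" using f by (simp add: square_integrable_fields_def)
  ultimately have "AE x in M. f x \<in> H (\<nu> x) \<and> (\<forall>p. c (fst p) (snd p) x = g p x)"
    by eventually_elim simp
  then obtain N where N: "N \<in> sets M" "emeasure M N = 0"
    and good: "\<And>x. x \<in> space M - N \<Longrightarrow> f x \<in> H (\<nu> x) \<and> (\<forall>p. c (fst p) (snd p) x = g p x)"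
    by (elim AE_E3) (auto simp: null_sets_def)
  define f' where "f' x = (if x \<in> N then 0 else f x)" for x
  have [measurable]: "N \<in> sets M" by (rule N)
  have f'_dense: "(\<lambda>x. if \<nu> x = m then cinner (f' x) (dense m i) else 0) \<in> borel_measurable M" for m i
  proof -
    have [measurable]: "g (m, i) \<in> borel_measurable M" by (rule g)
    have "(\<lambda>x. if x \<in> N then 0 else g (m, i) x) \<in> borel_measurable M" by measurable
    then show ?thesis
    proof (rule measurable_cong[THEN iffD1, rotated])
      fix x assume x: "x \<in> space M"
      have "g (m, i) x = c m i x" if "x \<notin> N"
        using conjunct2[OF good[of x], THEN spec, of "(m, i)"] that x by simp
      then show "(if x \<in> N then 0 else g (m, i) x) = (if \<nu> x = m then cinner (f' x) (dense m i) else 0)"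
        by (cases "x \<in> N") (simp_all add: f'_def c_def)
    qed
  qed
  have "measurable_field f'"
    unfolding measurable_field_def
  proof (intro conjI ballI allI)
    show "f' x \<in> H (\<nu> x)" if "x \<in> space M" for x using good[of x] that by (auto simp: f'_def)
    fix m h assume "h \<in> H m"
    then obtain i where i: "(\<lambda>n. dense m (i n)) \<longlonglongrightarrow> h" by (rule dense_limit)
    show "(\<lambda>x. if \<nu> x = m then cinner (f' x) h else 0) \<in> borel_measurable M"
    proof (rule borel_measurable_LIMSEQ_metric[OF f'_dense])
      show "(\<lambda>n. if \<nu> x = m then cinner (f' x) (dense m (i n)) else 0) \<longlonglongrightarrow>
        (if \<nu> x = m then cinner (f' x) h else 0)" for x
        using tendsto_cinner[OF tendsto_const i, of "f' x"] by (cases "\<nu> x = m") simp_all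
    qed
  qed
  moreover have "AE x in M. f x = f' x"
    using AE_not_in[of N M] N by (auto simp: f'_def null_sets_def)
  ultimately show ?thesis by (rule that)
qed

lemma square_integrable_fieldI:
  assumes f': "measurable_field f'" and eq: "AE x in M. f x = f' x"
    and fin: "(\<integral>\<^sup>+x. ennreal ((norm (f' x))\<^sup>2) \<partial>M) < \<infinity>"
  shows "f \<in> L2"
  unfolding square_integrable_fields_def level_set_restrict_completion
proof (intro CollectI conjI allI ballI)
  show "AE x in M. f x \<in> H (\<nu> x)"
    using eq AE_space by eventually_elim (simp add: measurable_field_in_fibre[OF f'])
  show "(\<lambda>x. if \<nu> x = m then cinner (f x) h else 0) \<in> borel_measurable (completion M)"
    if "h \<in> H m" for m h
    by (rule borel_measurable_completion_AE[OF measurable_field_coefficient[OF f' that]])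
      (use eq in eventually_elim, simp)
  have "(\<integral>\<^sup>+x. ennreal ((norm (f x))\<^sup>2) \<partial>completion M) = (\<integral>\<^sup>+x. ennreal ((norm (f' x))\<^sup>2) \<partial>M)"
    unfolding nn_integral_completion by (intro nn_integral_cong_AE) (use eq in eventually_elim, simp)
  then show "(\<integral>\<^sup>+x. ennreal ((norm (f x))\<^sup>2) \<partial>completion M) < \<infinity>" using fin by simp
qed

end

section \<open>The direct integral as a space of classes\<close>

lemma bounded_operatorsD:
  assumes T: "T \<in> bounded_operators (subspace_of_type V)"
  shows "u \<in> V \<Longrightarrow> T u \<in> V"
    and "u \<in> V \<Longrightarrow> v \<in> V \<Longrightarrow> T (u + v) = T u + T v"
    and "u \<in> V \<Longrightarrow> T (scaleC c u) = scaleC c (T u)"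
    and "u \<in> V \<Longrightarrow> T (scaleR r u) = scaleR r (T u)"
    and "\<exists>K. \<forall>v\<in>V. norm (T v) \<le> K * norm v"
  using T unfolding bounded_operators_def subspace_of_type_def vnorm_def
  by (auto simp: Re_cinner norm_eq_sqrt_inner[symmetric] scaleC_of_real[symmetric])

lemma continuous_on_bounded_operator:
  assumes T: "T \<in> bounded_operators (subspace_of_type V)" and V: "csubspace V"
  shows "continuous_on V T"
  unfolding continuous_on_iff
proof (intro ballI allI impI)
  fix v and e :: real assume v: "v \<in> V" and e: "e > 0"
  obtain K where K: "\<And>v. v \<in> V \<Longrightarrow> norm (T v) \<le> K * norm v" using bounded_operatorsD(5)[OF T] by blast
  show "\<exists>d>0. \<forall>u\<in>V. dist u v < d \<longrightarrow> dist (T u) (T v) < e"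
  proof (intro exI[of _ "e / (\<bar>K\<bar> + 1)"] conjI ballI impI)
    show "e / (\<bar>K\<bar> + 1) > 0" using e by simp
    fix u assume u: "u \<in> V" and d: "dist u v < e / (\<bar>K\<bar> + 1)"
    have uv: "u - v \<in> V" using V u v by (rule complex_vector.subspace_diff)
    have "T u = T (u - v) + T v" using bounded_operatorsD(2)[OF T uv v] by simp
    then have "dist (T u) (T v) = norm (T (u - v))" by (simp add: dist_norm)
    also have "\<dots> \<le> K * norm (u - v)" by (rule K[OF uv])
    also have "\<dots> \<le> (\<bar>K\<bar> + 1) * norm (u - v)" by (intro mult_right_mono) auto
    also have "\<dots> < e" using d by (simp add: dist_norm pos_less_divide_eq mult.commute)
    finally show "dist (T u) (T v) < e" .
  qed
qed

context hilbert_bundle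
begin

abbreviation "cl \<equiv> ae_class M \<nu> H"

lemma L2_regularization:
  assumes f: "f \<in> L2"
  obtains f' where "measurable_field f'" "AE x in M. f x = f' x" "(\<integral>\<^sup>+x. ennreal ((norm (f' x))\<^sup>2) \<partial>M) < \<infinity>"
proof -
  obtain f' where f': "measurable_field f'" "AE x in M. f x = f' x"
    by (rule square_integrable_field_regularization[OF f])
  have "(\<integral>\<^sup>+x. ennreal ((norm (f' x))\<^sup>2) \<partial>M) = (\<integral>\<^sup>+x. ennreal ((norm (f x))\<^sup>2) \<partial>completion M)"
    unfolding nn_integral_completion by (intro nn_integral_cong_AE) (use f'(2) in eventually_elim, simp)
  also have "\<dots> < \<infinity>" using f by (simp add: square_integrable_fields_def)
  finally show ?thesis by (rule that[OF f'])
qed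

lemma L2_in_fibre: "f \<in> L2 \<Longrightarrow> AE x in M. f x \<in> H (\<nu> x)"
  by (simp add: square_integrable_fields_def)

lemma L2_AE_cong:
  assumes f: "f \<in> L2" and eq: "AE x in M. k x = f x"
  shows "k \<in> L2"
proof -
  obtain f' where f': "measurable_field f'" "AE x in M. f x = f' x" "(\<integral>\<^sup>+x. ennreal ((norm (f' x))\<^sup>2) \<partial>M) < \<infinity>"
    by (rule L2_regularization[OF f])
  have "AE x in M. k x = f' x" using eq f'(2) by eventually_elim simp
  then show ?thesis by (rule square_integrable_fieldI[OF f'(1) _ f'(3)])
qed

lemma L2_add:
  assumes f: "f \<in> L2" and k: "k \<in> L2"
  shows "(\<lambda>x. f x + k x) \<in> L2"
proof -
  obtain f' where f': "measurable_field f'" "AE x in M. f x = f' x" "(\<integral>\<^sup>+x. ennreal ((norm (f' x))\<^sup>2) \<partial>M) < \<infinity>"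
    by (rule L2_regularization[OF f])
  obtain k' where k': "measurable_field k'" "AE x in M. k x = k' x" "(\<integral>\<^sup>+x. ennreal ((norm (k' x))\<^sup>2) \<partial>M) < \<infinity>"
    by (rule L2_regularization[OF k])
  note [measurable] = measurable_field_norm[OF f'(1)] measurable_field_norm[OF k'(1)]
  show ?thesis
  proof (rule square_integrable_fieldI)
    show "measurable_field (\<lambda>x. f' x + k' x)" by (intro measurable_field_add f' k')
    show "AE x in M. f x + k x = f' x + k' x" using f'(2) k'(2) by eventually_elim simp
    have "(norm (u + v))\<^sup>2 \<le> 2 * (norm u)\<^sup>2 + 2 * (norm v)\<^sup>2" for u v :: 'h
    proof -
      have "(norm (u + v))\<^sup>2 \<le> (norm u + norm v)\<^sup>2" by (intro power_mono norm_triangle_ineq) simp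
      also have "\<dots> \<le> 2 * (norm u)\<^sup>2 + 2 * (norm v)\<^sup>2"
        using sum_squares_bound[of "norm u" "norm v"] by (simp add: power2_sum)
      finally show ?thesis .
    qed
    then have "ennreal ((norm (f' x + k' x))\<^sup>2) \<le> 2 * ennreal ((norm (f' x))\<^sup>2) + 2 * ennreal ((norm (k' x))\<^sup>2)" for x
      by (simp add: ennreal_plus[symmetric] ennreal_mult''[symmetric] ennreal_numeral[symmetric]
          del: ennreal_plus ennreal_numeral)
    then have "(\<integral>\<^sup>+x. ennreal ((norm (f' x + k' x))\<^sup>2) \<partial>M) \<le>
      (\<integral>\<^sup>+x. 2 * ennreal ((norm (f' x))\<^sup>2) + 2 * ennreal ((norm (k' x))\<^sup>2) \<partial>M)"
      by (intro nn_integral_mono)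
    also have "\<dots> = 2 * (\<integral>\<^sup>+x. ennreal ((norm (f' x))\<^sup>2) \<partial>M) + 2 * (\<integral>\<^sup>+x. ennreal ((norm (k' x))\<^sup>2) \<partial>M)"
      by (simp add: nn_integral_add nn_integral_cmult)
    also have "\<dots> < \<infinity>" using f'(3) k'(3) by (simp add: ennreal_mult_less_top)
    finally show "(\<integral>\<^sup>+x. ennreal ((norm (f' x + k' x))\<^sup>2) \<partial>M) < \<infinity>" .
  qed
qed

lemma L2_scaleC:
  assumes f: "f \<in> L2"
  shows "(\<lambda>x. scaleC c (f x)) \<in> L2"
proof -
  obtain f' where f': "measurable_field f'" "AE x in M. f x = f' x" "(\<integral>\<^sup>+x. ennreal ((norm (f' x))\<^sup>2) \<partial>M) < \<infinity>"
    by (rule L2_regularization[OF f])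
  note [measurable] = measurable_field_norm[OF f'(1)]
  show ?thesis
  proof (rule square_integrable_fieldI)
    show "measurable_field (\<lambda>x. scaleC c (f' x))" by (intro measurable_field_scaleC f') simp
    show "AE x in M. scaleC c (f x) = scaleC c (f' x)" using f'(2) by eventually_elim simp
    have "(\<integral>\<^sup>+x. ennreal ((norm (scaleC c (f' x)))\<^sup>2) \<partial>M) =
      (\<integral>\<^sup>+x. ennreal ((cmod c)\<^sup>2) * ennreal ((norm (f' x))\<^sup>2) \<partial>M)"
      by (intro nn_integral_cong) (simp add: norm_scaleC power_mult_distrib ennreal_mult)
    also have "\<dots> = ennreal ((cmod c)\<^sup>2) * (\<integral>\<^sup>+x. ennreal ((norm (f' x))\<^sup>2) \<partial>M)"
      by (rule nn_integral_cmult) measurable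
    also have "\<dots> < \<infinity>" using f'(3) by (simp add: ennreal_mult_less_top)
    finally show "(\<integral>\<^sup>+x. ennreal ((norm (scaleC c (f' x)))\<^sup>2) \<partial>M) < \<infinity>" .
  qed
qed

lemma in_ae_class_iff: "f \<in> L2 \<Longrightarrow> k \<in> cl f \<longleftrightarrow> k \<in> L2 \<and> (AE x in M. f x = k x)"
  by (auto simp: ae_class_def ae_equal_def)

lemma ae_class_self: "f \<in> L2 \<Longrightarrow> f \<in> cl f"
  by (simp add: in_ae_class_iff)

lemma ae_class_eq:
  assumes "f \<in> L2" "AE x in M. k x = f x"
  shows "cl k = cl f"
proof -
  have k: "k \<in> L2" by (rule L2_AE_cong[OF assms])
  have "AE x in M. f x = j x" if "AE x in M. k x = j x" for j
    using that assms(2) by eventually_elim simp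
  moreover have "AE x in M. k x = j x" if "AE x in M. f x = j x" for j
    using that assms(2) by eventually_elim simp
  ultimately have "(AE x in M. k x = j x) \<longleftrightarrow> (AE x in M. f x = j x)" for j by blast
  then show ?thesis by (intro set_eqI) (simp add: in_ae_class_iff k assms(1))
qed

lemma direct_integral_carrier: "vcarrier (direct_integral M \<nu> H) = cl ` L2"
  by (auto simp: direct_integral_def quotient_def ae_class_def)

text \<open>
  The operations of the direct integral are unions over representatives; they collapse as soon
  as the operation respects almost everywhere equality.
\<close>

lemma UN_ae_class:
  assumes f: "f \<in> L2" and G: "\<And>k. k \<in> L2 \<Longrightarrow> AE x in M. k x = f x \<Longrightarrow> G k = G f"
  shows "(\<Union>k\<in>cl f. G k) = G f"
proof -
  have GF: "G k = G f" if "k \<in> cl f" for k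
  proof -
    have "k \<in> L2" "AE x in M. f x = k x" using that in_ae_class_iff[OF f] by simp_all
    moreover from this(2) have "AE x in M. k x = f x" by eventually_elim simp
    ultimately show ?thesis using G by blast
  qed
  show ?thesis by (rule UN_constant_eq[OF ae_class_self[OF f]]) (intro ballI GF)
qed

lemma vadd_ae_class:
  assumes f: "f \<in> L2" and k: "k \<in> L2"
  shows "vadd (direct_integral M \<nu> H) (cl f) (cl k) = cl (\<lambda>x. f x + k x)"
proof -
  have "(\<Union>f'\<in>cl f. \<Union>k'\<in>cl k. cl (\<lambda>x. f' x + k' x)) = (\<Union>f'\<in>cl f. cl (\<lambda>x. f' x + k x))"
  proof (intro SUP_cong refl UN_ae_class[OF k])
    fix f' k' assume "f' \<in> cl f" "k' \<in> L2" and eq: "AE x in M. k' x = k x"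
    then have "f' \<in> L2" by (simp add: in_ae_class_iff[OF f])
    moreover have "AE x in M. f' x + k' x = f' x + k x" using eq by eventually_elim simp
    ultimately show "cl (\<lambda>x. f' x + k' x) = cl (\<lambda>x. f' x + k x)"
      by (intro ae_class_eq L2_add k)
  qed
  also have "\<dots> = cl (\<lambda>x. f x + k x)"
  proof (rule UN_ae_class[OF f])
    fix f' assume "AE x in M. f' x = f x"
    then have "AE x in M. f' x + k x = f x + k x" by eventually_elim simp
    then show "cl (\<lambda>x. f' x + k x) = cl (\<lambda>x. f x + k x)"
      by (intro ae_class_eq L2_add f k)
  qed
  finally show ?thesis by (simp add: direct_integral_def)
qed

lemma vscale_ae_class:
  assumes f: "f \<in> L2"
  shows "vscale (direct_integral M \<nu> H) c (cl f) = cl (\<lambda>x. scaleC c (f x))"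
proof -
  have "(\<Union>f'\<in>cl f. cl (\<lambda>x. scaleC c (f' x))) = cl (\<lambda>x. scaleC c (f x))"
  proof (rule UN_ae_class[OF f])
    fix f' assume "AE x in M. f' x = f x"
    then have "AE x in M. scaleC c (f' x) = scaleC c (f x)" by eventually_elim simp
    then show "cl (\<lambda>x. scaleC c (f' x)) = cl (\<lambda>x. scaleC c (f x))"
      by (intro ae_class_eq L2_scaleC f)
  qed
  then show ?thesis by (simp add: direct_integral_def)
qed

lemma L2_cinner_measurable:
  assumes f: "f \<in> L2" and k: "k \<in> L2"
  shows "(\<lambda>x. cinner (f x) (k x)) \<in> borel_measurable (completion M)"
proof -
  obtain f' where f': "measurable_field f'" "AE x in M. f x = f' x"
    by (rule square_integrable_field_regularization[OF f])
  obtain k' where k': "measurable_field k'" "AE x in M. k x = k' x"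
    by (rule square_integrable_field_regularization[OF k])
  show ?thesis
    by (rule borel_measurable_completion_AE[OF measurable_field_cinner[OF f'(1) k'(1)]])
      (use f'(2) k'(2) in eventually_elim, simp)
qed

lemma vinner_ae_class:
  assumes f: "f \<in> L2" and k: "k \<in> L2"
  shows "vinner (direct_integral M \<nu> H) (cl f) (cl k) = (LINT x|completion M. cinner (f x) (k x))"
proof -
  let ?I = "\<lambda>f k. LINT x|completion M. cinner (f x) (k x)"
  have I: "?I f' k' = ?I f k" if "f' \<in> L2" "k' \<in> L2" "AE x in M. f' x = f x" "AE x in M. k' x = k x" for f' k'
  proof (intro integral_cong_AE L2_cinner_measurable that f k)
    have "AE x in M. cinner (f' x) (k' x) = cinner (f x) (k x)"
      using that(3,4) by eventually_elim simp
    then show "AE x in completion M. cinner (f' x) (k' x) = cinner (f x) (k x)" by (rule AE_completion)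
  qed
  have "(\<Union>f'\<in>cl f. \<Union>k'\<in>cl k. {?I f' k'}) = (\<Union>f'\<in>cl f. {?I f' k})"
  proof (intro SUP_cong refl UN_ae_class[OF k])
    fix f' k' assume f': "f' \<in> cl f" and k': "k' \<in> L2" "AE x in M. k' x = k x"
    have f'L: "f' \<in> L2" using f' by (simp add: in_ae_class_iff[OF f])
    have "AE x in M. f x = f' x" using f' by (simp add: in_ae_class_iff[OF f])
    then have "AE x in M. f' x = f x" by eventually_elim simp
    then show "{?I f' k'} = {?I f' k}" using I[OF f'L k'(1) _ k'(2)] I[OF f'L k] by simp
  qed
  also have "\<dots> = {?I f k}"
    by (rule UN_ae_class[OF f]) (use I[OF _ k] in simp)
  finally show ?thesis by (simp add: direct_integral_def)
qed

lemma vnorm_ae_class: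
  assumes f: "f \<in> L2"
  shows "vnorm (direct_integral M \<nu> H) (cl f) = sqrt (enn2real (\<integral>\<^sup>+x. ennreal ((norm (f x))\<^sup>2) \<partial>M))"
proof -
  have meas: "(\<lambda>x. (norm (f x))\<^sup>2) \<in> borel_measurable (completion M)"
  proof -
    have [measurable]: "(\<lambda>x. cinner (f x) (f x)) \<in> borel_measurable (completion M)"
      by (rule L2_cinner_measurable[OF f f])
    have "(\<lambda>x. Re (cinner (f x) (f x))) \<in> borel_measurable (completion M)" by measurable
    then show ?thesis by (simp add: cinner_self)
  qed
  have "vinner (direct_integral M \<nu> H) (cl f) (cl f) = of_real (LINT x|completion M. (norm (f x))\<^sup>2)"
    unfolding vinner_ae_class[OF f f] cinner_self by (rule integral_complex_of_real)
  also have "(LINT x|completion M. (norm (f x))\<^sup>2) = enn2real (\<integral>\<^sup>+x. ennreal ((norm (f x))\<^sup>2) \<partial>completion M)"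
    by (rule integral_eq_nn_integral[OF meas]) simp
  finally show ?thesis by (simp add: vnorm_def nn_integral_completion)
qed

end

section \<open>The representation attached to a cocycle\<close>

locale cocycle_bundle = nonsingular_action M \<pi> + hilbert_bundle M \<nu> H
  for M :: "'x measure"
    and \<pi> :: "'g::{topological_group_add, second_countable_topology, t2_space} \<Rightarrow> 'x \<Rightarrow> 'x"
    and \<nu> :: "'x \<Rightarrow> enat" and H :: "enat \<Rightarrow> 'h::complex_inner set" +
  fixes U :: "'g \<Rightarrow> 'x \<Rightarrow> 'h \<Rightarrow> 'h"
  assumes dimension_invariant: "invariant_ae \<pi> M \<nu>"
    and cocycle: "cocycle \<pi> M \<nu> H U"
begin

lemma AE_dimension: "AE x in M. \<nu> (\<pi> g x) = \<nu> x"
  using dimension_invariant unfolding invariant_ae_def by (simp add: eq_commute)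

lemma cocycle_operator: "x \<in> space M \<Longrightarrow> U g x \<in> bounded_operators (subspace_of_type (H (\<nu> x)))"
  using cocycle by (simp add: cocycle_def)

lemma cocycle_add: "AE x in M. \<forall>v\<in>H (\<nu> x). U (g + h) x v = U g (\<pi> h x) (U h x v)"
  using cocycle by (simp add: cocycle_def)

lemma cocycle_zero: "AE x in M. \<forall>v\<in>H (\<nu> x). U 0 x v = v"
  using cocycle by (simp add: cocycle_def)

lemma cocycle_measurable:
  assumes "u \<in> H m" "v \<in> H m"
  shows "(\<lambda>y. if \<nu> (snd y) = m then cinner (U (fst y) (snd y) u) v else 0) \<in> borel_measurable (borel \<Otimes>\<^sub>M M)"
proof -
  let ?L = "level_set M \<nu> m"
  have L: "?L \<in> sets M" unfolding level_set_def by measurable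
  let ?R = "restrict_space (borel \<Otimes>\<^sub>M M) (UNIV \<times> ?L)"
  have "(\<lambda>(g, x). cinner (U g x u) v) \<in> borel_measurable (borel \<Otimes>\<^sub>M restrict_space M ?L)"
    using cocycle assms by (simp add: cocycle_def)
  moreover have "(\<lambda>y. y) \<in> ?R \<rightarrow>\<^sub>M borel \<Otimes>\<^sub>M restrict_space M ?L"
  proof -
    have "fst \<in> ?R \<rightarrow>\<^sub>M borel" by (intro measurable_restrict_space1 measurable_fst)
    moreover have "snd \<in> ?R \<rightarrow>\<^sub>M restrict_space M ?L"
      by (intro measurable_restrict_space2 measurable_restrict_space1 measurable_snd)
        (auto simp: space_restrict_space)
    ultimately have "(\<lambda>y. (fst y, snd y)) \<in> ?R \<rightarrow>\<^sub>M borel \<Otimes>\<^sub>M restrict_space M ?L"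
      by (rule measurable_Pair)
    then show ?thesis by simp
  qed
  ultimately have "(\<lambda>(g, x). cinner (U g x u) v) \<in> borel_measurable ?R"
    by (rule measurable_compose[rotated])
  moreover have "UNIV \<times> ?L \<inter> space (borel \<Otimes>\<^sub>M M) \<in> sets (borel \<Otimes>\<^sub>M M)"
    using L by (intro sets.Int pair_measureI) auto
  ultimately have "(\<lambda>y. if y \<in> UNIV \<times> ?L then (\<lambda>(g, x). cinner (U g x u) v) y else 0) \<in> borel_measurable (borel \<Otimes>\<^sub>M M)"
    by (subst measurable_restrict_space_iff[symmetric]) simp_all
  then show ?thesis
    by (rule measurable_cong[THEN iffD1, rotated])
      (auto simp: level_set_def space_pair_measure split_beta)
qed

text \<open>
  The operator with decomposition \<open>U g\<close> sends the class of \<open>f\<close> to a class whose members agree with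
  \<open>x \<mapsto> U g x (f x)\<close> almost everywhere. Hence that function is itself a square integrable field, although
  the fibre operators alone carry no uniform bound.
\<close>

lemma cocycle_L2_bounded:
  "\<exists>K. \<forall>f\<in>L2. (\<lambda>x. U g x (f x)) \<in> L2 \<and>
    vnorm (direct_integral M \<nu> H) (cl (\<lambda>x. U g x (f x))) \<le> K * vnorm (direct_integral M \<nu> H) (cl f)"
proof -
  obtain T where T: "T \<in> bounded_operators (direct_integral M \<nu> H)" "has_decomposition M \<nu> H T (U g)"
    using cocycle unfolding cocycle_def by blast
  obtain K where K: "\<forall>F\<in>vcarrier (direct_integral M \<nu> H).
    vnorm (direct_integral M \<nu> H) (T F) \<le> K * vnorm (direct_integral M \<nu> H) F"
    using T(1) unfolding bounded_operators_def by blast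
  have "(\<lambda>x. U g x (f x)) \<in> L2 \<and>
    vnorm (direct_integral M \<nu> H) (cl (\<lambda>x. U g x (f x))) \<le> K * vnorm (direct_integral M \<nu> H) (cl f)"
    if f: "f \<in> L2" for f
  proof -
    have F: "cl f \<in> vcarrier (direct_integral M \<nu> H)" using f by (simp add: direct_integral_carrier)
    then have "T (cl f) \<in> vcarrier (direct_integral M \<nu> H)"
      using T(1) unfolding bounded_operators_def by blast
    then obtain k where k: "k \<in> L2" "T (cl f) = cl k" by (auto simp: direct_integral_carrier)
    have "AE x in M. k x = U g x (f x)"
      using T(2) F ae_class_self[OF f] ae_class_self[OF k(1)] k(2) unfolding has_decomposition_def by blast
    then have "AE x in M. U g x (f x) = k x" by eventually_elim simp
    then have "(\<lambda>x. U g x (f x)) \<in> L2" and eq: "cl (\<lambda>x. U g x (f x)) = T (cl f)"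
      unfolding k(2) by (rule L2_AE_cong[OF k(1)], rule ae_class_eq[OF k(1)])
    moreover have "vnorm (direct_integral M \<nu> H) (T (cl f)) \<le> K * vnorm (direct_integral M \<nu> H) (cl f)"
      using K F by (rule bspec)
    ultimately show ?thesis by (simp only: simp_thms)
  qed
  then show ?thesis by blast
qed

abbreviation "D g x \<equiv> translation_derivative \<pi> M (- g) x"

lemma translation_derivative_measurable [measurable]: "translation_derivative \<pi> M g \<in> borel_measurable M"
  unfolding translation_derivative_def by measurable

lemma translation_derivative_nonneg [simp]: "0 \<le> translation_derivative \<pi> M g x"
  by (simp add: translation_derivative_def)

lemma nn_integral_translate:
  assumes [measurable]: "F \<in> borel_measurable M"
  shows "(\<integral>\<^sup>+x. ennreal (D g x) * F (\<pi> (- g) x) \<partial>M) = (\<integral>\<^sup>+x. F x \<partial>M)"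
proof -
  have "(\<integral>\<^sup>+x. ennreal (D g x) * F (\<pi> (- g) x) \<partial>M) =
    (\<integral>\<^sup>+x. F (\<pi> (- g) x) \<partial>density M (\<lambda>x. ennreal (D g x)))"
    by (rule nn_integral_density[symmetric]) measurable
  also have "\<dots> = (\<integral>\<^sup>+x. F (\<pi> (- g) (\<pi> g x)) \<partial>M)"
    unfolding density_translation_derivative by (rule nn_integral_distr) measurable
  also have "\<dots> = (\<integral>\<^sup>+x. F x \<partial>M)"
    by (intro nn_integral_cong) simp
  finally show ?thesis .
qed

text \<open>
  The square of the weight is the density of the translated measure, so the norm integral is
  unchanged by the substitution. Where \<open>\<nu>\<close> is not invariant, a null set, the strict representative is put to
  0 in order to stay in the right fibre.
\<close>

lemma L2_translate:
  assumes k: "k \<in> L2"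
  shows "(\<lambda>x. sqrt (D g x) *\<^sub>R k (\<pi> (- g) x)) \<in> L2"
    and "vnorm (direct_integral M \<nu> H) (cl (\<lambda>x. sqrt (D g x) *\<^sub>R k (\<pi> (- g) x))) =
      vnorm (direct_integral M \<nu> H) (cl k)"
proof -
  obtain k' where k': "measurable_field k'" "AE x in M. k x = k' x" "(\<integral>\<^sup>+x. ennreal ((norm (k' x))\<^sup>2) \<partial>M) < \<infinity>"
    by (rule L2_regularization[OF k])
  note [measurable] = measurable_field_norm[OF k'(1)]
  define t where "t x = sqrt (D g x) *\<^sub>R (if \<nu> (\<pi> (- g) x) = \<nu> x then k' (\<pi> (- g) x) else 0)" for x
  have "measurable_field t"
    unfolding measurable_field_def
  proof (intro conjI ballI allI)
    fix x assume "x \<in> space M"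
    then have "k' (\<pi> (- g) x) \<in> H (\<nu> (\<pi> (- g) x))" by (intro measurable_field_in_fibre[OF k'(1)]) simp
    then show "t x \<in> H (\<nu> x)" by (auto simp: t_def intro!: scaleR_in_fibre)
  next
    fix m h assume h: "h \<in> H m"
    define c where "c x = (if \<nu> x = m then cinner (k' x) h else 0)" for x
    have [measurable]: "c \<in> borel_measurable M"
      unfolding c_def by (rule measurable_field_coefficient[OF k'(1) h])
    have "(\<lambda>x. complex_of_real (sqrt (D g x)) * (if \<nu> x = m then c (\<pi> (- g) x) else 0)) \<in> borel_measurable M"
      by measurable
    then show "(\<lambda>x. if \<nu> x = m then cinner (t x) h else 0) \<in> borel_measurable M"
      by (rule back_subst[where P = "\<lambda>f. f \<in> borel_measurable M"])
        (auto simp: c_def t_def cinner_scaleR_left fun_eq_iff)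
  qed
  moreover have eq: "AE x in M. sqrt (D g x) *\<^sub>R k (\<pi> (- g) x) = t x"
    using AE_act[OF k'(2), of "- g"] AE_dimension[of "- g"] by eventually_elim (simp add: t_def)
  moreover have nt: "(\<integral>\<^sup>+x. ennreal ((norm (t x))\<^sup>2) \<partial>M) = (\<integral>\<^sup>+x. ennreal ((norm (k' x))\<^sup>2) \<partial>M)"
  proof -
    have "(\<integral>\<^sup>+x. ennreal ((norm (t x))\<^sup>2) \<partial>M) = (\<integral>\<^sup>+x. ennreal (D g x) * ennreal ((norm (k' (\<pi> (- g) x)))\<^sup>2) \<partial>M)"
    proof (intro nn_integral_cong_AE)
      show "AE x in M. ennreal ((norm (t x))\<^sup>2) = ennreal (D g x) * ennreal ((norm (k' (\<pi> (- g) x)))\<^sup>2)"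
        using AE_dimension[of "- g"]
        by eventually_elim (simp add: t_def power_mult_distrib ennreal_mult)
    qed
    also have "\<dots> = (\<integral>\<^sup>+x. ennreal ((norm (k' x))\<^sup>2) \<partial>M)"
      by (rule nn_integral_translate) measurable
    finally show ?thesis .
  qed
  ultimately show *: "(\<lambda>x. sqrt (D g x) *\<^sub>R k (\<pi> (- g) x)) \<in> L2"
    using k'(3) square_integrable_fieldI by metis
  have "(\<integral>\<^sup>+x. ennreal ((norm (sqrt (D g x) *\<^sub>R k (\<pi> (- g) x)))\<^sup>2) \<partial>M) = (\<integral>\<^sup>+x. ennreal ((norm (t x))\<^sup>2) \<partial>M)"
    by (rule nn_integral_cong_AE) (use eq in eventually_elim, simp)
  also have "\<dots> = (\<integral>\<^sup>+x. ennreal ((norm (k x))\<^sup>2) \<partial>M)"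
    unfolding nt by (rule nn_integral_cong_AE) (use k'(2) in eventually_elim, simp)
  finally show "vnorm (direct_integral M \<nu> H) (cl (\<lambda>x. sqrt (D g x) *\<^sub>R k (\<pi> (- g) x))) =
      vnorm (direct_integral M \<nu> H) (cl k)"
    by (simp only: vnorm_ae_class[OF *] vnorm_ae_class[OF k])
qed

definition act_field :: "'g \<Rightarrow> ('x \<Rightarrow> 'h) \<Rightarrow> 'x \<Rightarrow> 'h" where
  "act_field g f x = sqrt (D g x) *\<^sub>R U g (\<pi> (- g) x) (f (\<pi> (- g) x))"

lemma act_field_L2:
  assumes "f \<in> L2"
  shows "act_field g f \<in> L2"
proof -
  have "(\<lambda>x. U g x (f x)) \<in> L2" using cocycle_L2_bounded[of g] assms by blast
  from L2_translate(1)[OF this] show ?thesis by (simp add: act_field_def[abs_def])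
qed

lemma act_field_bounded:
  "\<exists>K. \<forall>f\<in>L2. vnorm (direct_integral M \<nu> H) (cl (act_field g f)) \<le> K * vnorm (direct_integral M \<nu> H) (cl f)"
proof -
  obtain K where K: "\<forall>f\<in>L2. (\<lambda>x. U g x (f x)) \<in> L2 \<and>
    vnorm (direct_integral M \<nu> H) (cl (\<lambda>x. U g x (f x))) \<le> K * vnorm (direct_integral M \<nu> H) (cl f)"
    using cocycle_L2_bounded[of g] by blast
  have "vnorm (direct_integral M \<nu> H) (cl (act_field g f)) \<le> K * vnorm (direct_integral M \<nu> H) (cl f)"
    if "f \<in> L2" for f
  proof -
    have Uf: "(\<lambda>x. U g x (f x)) \<in> L2" using K that by blast
    show ?thesis
      using L2_translate(2)[OF Uf, of g] K that by (simp add: act_field_def[abs_def])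
  qed
  then show ?thesis by blast
qed

lemma act_field_AE_cong:
  assumes "AE x in M. f x = k x"
  shows "AE x in M. act_field g f x = act_field g k x"
  using AE_act[OF assms, of "- g"] by eventually_elim (simp add: act_field_def)

lemma cocycle_representation_ae_class:
  assumes f: "f \<in> L2"
  shows "cocycle_representation \<pi> M \<nu> H U g (cl f) = cl (act_field g f)"
proof -
  have "(\<Union>f\<in>cl f. cl (act_field g f)) = cl (act_field g f)"
  proof (rule UN_ae_class[OF f])
    fix k assume "AE x in M. k x = f x"
    then have "AE x in M. act_field g k x = act_field g f x" by (rule act_field_AE_cong)
    then show "cl (act_field g k) = cl (act_field g f)" by (rule ae_class_eq[OF act_field_L2[OF f]])
  qed
  then show ?thesis by (simp add: cocycle_representation_def act_field_def[abs_def])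
qed

lemma act_field_add:
  assumes f: "f \<in> L2" and k: "k \<in> L2"
  shows "AE x in M. act_field g (\<lambda>x. f x + k x) x = act_field g f x + act_field g k x"
  using AE_act[OF L2_in_fibre[OF f], of "- g"] AE_act[OF L2_in_fibre[OF k], of "- g"] AE_space
  by eventually_elim
    (simp add: act_field_def bounded_operatorsD(2)[OF cocycle_operator] scaleR_add_right)

lemma act_field_scaleC:
  assumes f: "f \<in> L2"
  shows "AE x in M. act_field g (\<lambda>x. scaleC c (f x)) x = scaleC c (act_field g f x)"
  using AE_act[OF L2_in_fibre[OF f], of "- g"] AE_space
  by eventually_elim
    (simp add: act_field_def bounded_operatorsD(3)[OF cocycle_operator] scaleC_of_real_scaleR)

lemma density_eq_imp_AE_eq:
  assumes [measurable]: "a \<in> borel_measurable M" "b \<in> borel_measurable M"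
    and nonneg: "\<And>x. 0 \<le> a x" "\<And>x. 0 \<le> b x"
    and eq: "density M (\<lambda>x. ennreal (a x)) = density M (\<lambda>x. ennreal (b x))"
  shows "AE x in M. a x = b x"
proof -
  have "AE x in M. ennreal (a x) = RN_deriv M (density M (\<lambda>x. ennreal (b x))) x"
    by (rule RN_deriv_unique[OF _ eq]) measurable
  moreover have "AE x in M. ennreal (b x) = RN_deriv M (density M (\<lambda>x. ennreal (b x))) x"
    by (rule RN_deriv_unique[OF _ refl]) measurable
  ultimately have "AE x in M. ennreal (a x) = ennreal (b x)" by eventually_elim simp
  then show ?thesis by eventually_elim (simp add: nonneg)
qed

text \<open>
  Both sides are densities of the same measure, the image of \<open>M\<close> under \<open>\<pi> (g + h) = \<pi> g \<circ> \<pi> h\<close>.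
\<close>

lemma derivative_chain_rule: "AE x in M. D (g + h) x = D g x * D h (\<pi> (- g) x)"
proof (rule density_eq_imp_AE_eq)
  have "density M (\<lambda>x. ennreal (D g x * D h (\<pi> (- g) x))) =
    density M (\<lambda>x. ennreal (D g x) * ennreal (D h (\<pi> (- g) x)))"
    by (simp add: ennreal_mult)
  also have "\<dots> = density (density M (\<lambda>x. ennreal (D g x))) (\<lambda>x. ennreal (D h (\<pi> (- g) x)))"
    by (intro density_density_eq[symmetric]) measurable
  also have "\<dots> = distr (density M (\<lambda>x. ennreal (D h (\<pi> (- g) (\<pi> g x))))) M (\<pi> g)"
    unfolding density_translation_derivative by (intro density_distr) measurable
  also have "density M (\<lambda>x. ennreal (D h (\<pi> (- g) (\<pi> g x)))) = density M (\<lambda>x. ennreal (D h x))"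
    by (intro density_cong) auto
  also have "\<dots> = distr M M (\<pi> h)" by (rule density_translation_derivative)
  also have "distr (distr M M (\<pi> h)) M (\<pi> g) = distr M M (\<pi> (g + h))"
    by (subst distr_distr) (auto intro!: distr_cong simp: act_add)
  also have "\<dots> = density M (\<lambda>x. ennreal (D (g + h) x))" by (rule density_translation_derivative[symmetric])
  finally show "density M (\<lambda>x. ennreal (D (g + h) x)) = density M (\<lambda>x. ennreal (D g x * D h (\<pi> (- g) x)))" ..
qed (measurable; simp)+

text \<open>
  With \<open>y = \<pi> (- g) x\<close> and \<open>z = \<pi> (- h) y\<close>, the cocycle identity is used at \<open>z\<close>, for which \<open>\<pi> h z = y\<close>. The
  exceptional null sets are transported from \<open>z\<close> to \<open>x\<close> by nonsingularity.
\<close>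

lemma act_field_compose:
  assumes f: "f \<in> L2"
  shows "AE x in M. act_field (g + h) f x = act_field g (act_field h f) x"
proof -
  have "AE x in M. f x \<in> H (\<nu> x) \<and> (\<forall>v\<in>H (\<nu> x). U (g + h) x v = U g (\<pi> h x) (U h x v)) \<and> \<nu> (\<pi> h x) = \<nu> x"
    using L2_in_fibre[OF f] cocycle_add[of g h] AE_dimension[of h] by eventually_elim blast
  from AE_act[OF this, of "- (g + h)"] derivative_chain_rule[of g h] AE_space
  show ?thesis
  proof eventually_elim
    fix x
    define y where "y = \<pi> (- g) x"
    define z where "z = \<pi> (- (g + h)) x"
    assume prem: "f (\<pi> (- (g + h)) x) \<in> H (\<nu> (\<pi> (- (g + h)) x)) \<and>
      (\<forall>v\<in>H (\<nu> (\<pi> (- (g + h)) x)). U (g + h) (\<pi> (- (g + h)) x) v =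
        U g (\<pi> h (\<pi> (- (g + h)) x)) (U h (\<pi> (- (g + h)) x) v)) \<and>
      \<nu> (\<pi> h (\<pi> (- (g + h)) x)) = \<nu> (\<pi> (- (g + h)) x)"
      and chain: "D (g + h) x = D g x * D h (\<pi> (- g) x)" and x: "x \<in> space M"
    have z: "z = \<pi> (- h) y" "z \<in> space M" "y \<in> space M" "\<pi> h z = y"
      using x by (simp_all add: z_def y_def minus_add act_add del: add_uminus_conv_diff)
    have fz: "f z \<in> H (\<nu> z)" and Uz: "U (g + h) z (f z) = U g y (U h z (f z))" and \<nu>: "\<nu> y = \<nu> z"
      using prem unfolding z_def[symmetric] z(4) by auto
    have "U h z (f z) \<in> H (\<nu> y)"
      unfolding \<nu> by (rule bounded_operatorsD(1)[OF cocycle_operator[OF z(2)] fz])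
    then have "U g y (sqrt (D h y) *\<^sub>R U h z (f z)) = sqrt (D h y) *\<^sub>R U g y (U h z (f z))"
      by (rule bounded_operatorsD(4)[OF cocycle_operator[OF z(3)]])
    then show "act_field (g + h) f x = act_field g (act_field h f) x"
      unfolding act_field_def chain y_def[symmetric] z_def[symmetric] z(1)[symmetric] Uz
      by (simp add: real_sqrt_mult)
  qed
qed

lemma act_field_zero:
  assumes f: "f \<in> L2"
  shows "AE x in M. act_field 0 f x = f x"
proof -
  have "AE x in M. D 0 x = 1"
  proof (rule density_eq_imp_AE_eq)
    have "density M (\<lambda>x. ennreal (D 0 x)) = distr M M (\<lambda>x. x)"
      unfolding density_translation_derivative by (intro distr_cong) (simp_all add: act_zero)
    then show "density M (\<lambda>x. ennreal (D 0 x)) = density M (\<lambda>x. ennreal 1)" by (simp add: density_1)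
  qed simp_all
  then show ?thesis
    using cocycle_zero L2_in_fibre[OF f] AE_space
    by eventually_elim (simp add: act_field_def act_zero)
qed

text \<open>
  For each fixed \<open>g\<close> the integrand is changed on a null set only: \<open>f\<close> and \<open>k\<close> are replaced by strict
  measurable fields, the derivative by its jointly measurable version, and the points where
  \<open>\<nu> (\<pi> (- g) x) \<noteq> \<nu> x\<close> are discarded. The new integrand is jointly measurable in \<open>(g, x)\<close>.
\<close>

lemma coefficient_measurable:
  assumes f: "f \<in> L2" and k: "k \<in> L2"
  shows "(\<lambda>g. vinner (direct_integral M \<nu> H) (cl (act_field g f)) (cl k)) \<in> borel_measurable borel"
proof -
  obtain f' where f': "measurable_field f'" "AE x in M. f x = f' x"
    by (rule square_integrable_field_regularization[OF f])
  obtain k' where k': "measurable_field k'" "AE x in M. k x = k' x"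
    by (rule square_integrable_field_regularization[OF k])
  obtain J where Jm [measurable]: "J \<in> borel_measurable (borel \<Otimes>\<^sub>M M)"
    and J: "\<And>g. density M (\<lambda>x. J (g, x)) = distr M M (\<pi> g)"
    using jointly_measurable_density by blast
  have J_eq: "AE x in M. enn2real (J (g, x)) = D g x" for g
  proof -
    have "AE x in M. J (g, x) = RN_deriv M (distr M M (\<pi> g)) x"
      by (rule RN_deriv_unique[OF _ J]) measurable
    then show ?thesis
      unfolding translation_derivative_def translated_measure_eq_distr by eventually_elim simp
  qed
  define p where "p y = \<pi> (- fst y) (snd y)" for y
  have p [measurable]: "p \<in> borel \<Otimes>\<^sub>M M \<rightarrow>\<^sub>M M" unfolding p_def by measurable
  have p_space: "y \<in> space (borel \<Otimes>\<^sub>M M) \<Longrightarrow> p y \<in> space M" for y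
    by (rule measurable_space[OF p])
  define F where "F y = (if \<nu> (p y) = \<nu> (snd y) then cinner (U (fst y) (p y) (f' (p y))) (k' (snd y)) else 0)" for y
  have F [measurable]: "F \<in> borel_measurable (borel \<Otimes>\<^sub>M M)"
  proof (rule borel_measurable_levels[where p = snd])
    fix m
    \<comment> \<open>both points lie over level \<open>m\<close>, so that only the one fibre \<open>H m\<close> is involved\<close>
    define P where "P y \<longleftrightarrow> \<nu> (snd y) = m \<and> \<nu> (p y) = m" for y :: "'g \<times> 'x"
    have restrict: "(\<lambda>y. if P y then c y else 0) \<in> borel_measurable (borel \<Otimes>\<^sub>M M)"
      if "(\<lambda>y. if \<nu> (p y) = m then c y else 0) \<in> borel_measurable (borel \<Otimes>\<^sub>M M)"
      for c :: "'g \<times> 'x \<Rightarrow> 'b::real_normed_vector"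
    proof -
      note [measurable] = that
      have "(\<lambda>y. if \<nu> (snd y) = m then (if \<nu> (p y) = m then c y else 0) else 0) \<in> borel_measurable (borel \<Otimes>\<^sub>M M)"
        by measurable
      then show ?thesis
        by (rule back_subst[where P = "\<lambda>f. f \<in> borel_measurable (borel \<Otimes>\<^sub>M M)"]) (auto simp: P_def)
    qed
    have operator: "P y \<Longrightarrow> y \<in> space (borel \<Otimes>\<^sub>M M) \<Longrightarrow> U (fst y) (p y) \<in> bounded_operators (subspace_of_type (H m))" for y
      using cocycle_operator[OF p_space, of y "fst y"] by (auto simp: P_def)
    have f'_fibre: "P y \<Longrightarrow> y \<in> space (borel \<Otimes>\<^sub>M M) \<Longrightarrow> f' (p y) \<in> H m" for y
      using measurable_field_in_fibre[OF f'(1) p_space, of y] by (auto simp: P_def)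
    have k'_fibre: "P y \<Longrightarrow> y \<in> space (borel \<Otimes>\<^sub>M M) \<Longrightarrow> k' (snd y) \<in> H m" for y
      using measurable_field_in_fibre[OF k'(1), of "snd y"] by (auto simp: P_def space_pair_measure)
    have "(\<lambda>y. if P y then cinner (U (fst y) (p y) (f' (p y))) (k' (snd y)) else 0) \<in> borel_measurable (borel \<Otimes>\<^sub>M M)"
    proof (rule borel_measurable_substitute[where m = m
          and \<Phi> = "\<lambda>y v. cinner (U (fst y) (p y) (f' (p y))) v" and f = "\<lambda>y. k' (snd y)"])
      fix v assume v: "v \<in> H m"
      show "(\<lambda>y. if P y then cinner (U (fst y) (p y) (f' (p y))) v else 0) \<in> borel_measurable (borel \<Otimes>\<^sub>M M)"
      proof (rule borel_measurable_substitute[where m = m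
            and \<Phi> = "\<lambda>y u. cinner (U (fst y) (p y) u) v" and f = "\<lambda>y. f' (p y)"])
        fix u assume u: "u \<in> H m"
        have "(\<lambda>y. (fst y, p y)) \<in> borel \<Otimes>\<^sub>M M \<rightarrow>\<^sub>M borel \<Otimes>\<^sub>M M" by measurable
        from measurable_compose[OF this cocycle_measurable[OF u v]]
        show "(\<lambda>y. if P y then cinner (U (fst y) (p y) u) v else 0) \<in> borel_measurable (borel \<Otimes>\<^sub>M M)"
          unfolding fst_conv snd_conv by (rule restrict)
        from measurable_compose[OF p measurable_field_norm_diff[OF f'(1) u]]
        show "(\<lambda>y. if P y then norm (f' (p y) - u) else 0) \<in> borel_measurable (borel \<Otimes>\<^sub>M M)"
          by (rule restrict)
      next
        fix y assume "y \<in> space (borel \<Otimes>\<^sub>M M)" "P y"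
        then show "continuous_on (H m) (\<lambda>u. cinner (U (fst y) (p y) u) v)"
          by (intro continuous_intros continuous_on_bounded_operator csubspace_fibre operator)
      qed (rule f'_fibre)
      have [measurable]: "(\<lambda>y. if \<nu> (snd y) = m then norm (k' (snd y) - v) else 0) \<in> borel_measurable (borel \<Otimes>\<^sub>M M)"
        by (rule measurable_compose[OF measurable_snd measurable_field_norm_diff[OF k'(1) v]])
      have "(\<lambda>y. if \<nu> (p y) = m then (if \<nu> (snd y) = m then norm (k' (snd y) - v) else 0) else 0) \<in> borel_measurable (borel \<Otimes>\<^sub>M M)"
        by measurable
      then show "(\<lambda>y. if P y then norm (k' (snd y) - v) else 0) \<in> borel_measurable (borel \<Otimes>\<^sub>M M)"
        by (rule back_subst[where P = "\<lambda>f. f \<in> borel_measurable (borel \<Otimes>\<^sub>M M)"]) (auto simp: P_def)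
    qed (auto intro!: continuous_intros k'_fibre)
    then show "(\<lambda>y. if \<nu> (snd y) = m then F y else 0) \<in> borel_measurable (borel \<Otimes>\<^sub>M M)"
      by (rule back_subst[where P = "\<lambda>f. f \<in> borel_measurable (borel \<Otimes>\<^sub>M M)"]) (auto simp: P_def F_def)
  qed simp
  define \<psi> where "\<psi> y = complex_of_real (sqrt (enn2real (J y))) * F y" for y
  have \<psi> [measurable]: "\<psi> \<in> borel_measurable (borel \<Otimes>\<^sub>M M)" unfolding \<psi>_def by measurable
  have "vinner (direct_integral M \<nu> H) (cl (act_field g f)) (cl k) = (LINT x|M. \<psi> (g, x))" for g
  proof -
    have \<psi>g: "(\<lambda>x. \<psi> (g, x)) \<in> borel_measurable M"
      using measurable_Pair2[OF \<psi>] by simp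
    have "AE x in M. cinner (act_field g f x) (k x) = \<psi> (g, x)"
      using AE_act[OF f'(2), of "- g"] k'(2) J_eq[of g] AE_dimension[of "- g"]
      by eventually_elim (simp add: \<psi>_def F_def p_def act_field_def cinner_scaleR_left)
    then have "AE x in completion M. cinner (act_field g f x) (k x) = \<psi> (g, x)" by (rule AE_completion)
    then have "(LINT x|completion M. cinner (act_field g f x) (k x)) = (LINT x|completion M. \<psi> (g, x))"
      by (rule integral_cong_AE[OF L2_cinner_measurable[OF act_field_L2[OF f] k] measurable_completion[OF \<psi>g]])
    also have "\<dots> = (LINT x|M. \<psi> (g, x))" by (rule integral_completion[OF \<psi>g])
    finally show ?thesis by (simp only: vinner_ae_class[OF act_field_L2[OF f] k])
  qed
  moreover have "(\<lambda>g. LINT x|M. \<psi> (g, x)) \<in> borel_measurable borel"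
    by (rule borel_measurable_lebesgue_integral) simp
  ultimately show ?thesis by simp
qed

lemma group_representation_cocycle:
  "group_representation (direct_integral M \<nu> H) (cocycle_representation \<pi> M \<nu> H U)"
  unfolding group_representation_def
proof (intro conjI allI ballI)
  let ?S = "direct_integral M \<nu> H" and ?\<phi> = "cocycle_representation \<pi> M \<nu> H U"
  note carrier = direct_integral_carrier and \<phi> = cocycle_representation_ae_class
  show "?\<phi> g \<in> bounded_operators ?S" for g
    unfolding bounded_operators_def
  proof (intro CollectI conjI funcsetI ballI allI)
    fix F assume "F \<in> vcarrier ?S"
    then obtain f where f: "f \<in> L2" "F = cl f" by (auto simp: carrier)
    show "?\<phi> g F \<in> vcarrier ?S" using f act_field_L2 by (auto simp: \<phi> carrier)
    show "?\<phi> g (vscale ?S c F) = vscale ?S c (?\<phi> g F)" for c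
      using ae_class_eq[OF L2_scaleC[OF act_field_L2[OF f(1)]] act_field_scaleC[OF f(1), of g c]]
      by (simp add: f \<phi> vscale_ae_class L2_scaleC act_field_L2)
    fix K assume "K \<in> vcarrier ?S"
    then obtain k where k: "k \<in> L2" "K = cl k" by (auto simp: carrier)
    show "?\<phi> g (vadd ?S F K) = vadd ?S (?\<phi> g F) (?\<phi> g K)"
      using ae_class_eq[OF L2_add[OF act_field_L2[OF f(1)] act_field_L2[OF k(1)]] act_field_add[OF f(1) k(1), of g]]
      by (simp add: f k \<phi> vadd_ae_class L2_add act_field_L2)
  next
    obtain K where "\<forall>f\<in>L2. vnorm ?S (cl (act_field g f)) \<le> K * vnorm ?S (cl f)"
      using act_field_bounded by blast
    then show "\<exists>K. \<forall>F\<in>vcarrier ?S. vnorm ?S (?\<phi> g F) \<le> K * vnorm ?S F"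
      by (intro exI[of _ K]) (auto simp: carrier \<phi>)
  qed
  fix F assume "F \<in> vcarrier ?S"
  then obtain f where f: "f \<in> L2" "F = cl f" by (auto simp: carrier)
  show "?\<phi> (g + h) F = ?\<phi> g (?\<phi> h F)" for g h
    using ae_class_eq[OF act_field_L2[OF act_field_L2[OF f(1)]] act_field_compose[OF f(1)]]
    by (simp add: f \<phi> act_field_L2)
  show "?\<phi> 0 F = F"
    using ae_class_eq[OF f(1) act_field_zero[OF f(1)]] by (simp add: f \<phi>)
  fix K assume "K \<in> vcarrier ?S"
  then obtain k where k: "k \<in> L2" "K = cl k" by (auto simp: carrier)
  show "(\<lambda>g. vinner ?S (?\<phi> g F) K) \<in> borel_measurable borel"
    using coefficient_measurable[OF f(1) k(1)] by (simp add: f k \<phi>)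
qed

end

theorem mainTheorem1:
  fixes \<pi> :: "'g::{topological_group_add, second_countable_topology, t2_space} \<Rightarrow> 'x \<Rightarrow> 'x"
    and X :: "'x topology"
    and M :: "'x measure"
    and \<nu> :: "'x \<Rightarrow> enat"
    and H :: "enat \<Rightarrow> 'h::complex_inner set"
    and U :: "'g \<Rightarrow> 'x \<Rightarrow> 'h \<Rightarrow> 'h"
  assumes "locally compact (UNIV :: 'g set)"
    and "\<And>m. separable_hilbert_space (H m) m"
    and "topspace X = space M"
    and "sigma_finite_measure M"
    and "group_action X \<pi>"
    and "(\<lambda>(g, x). \<pi> g x) \<in> borel \<Otimes>\<^sub>M M \<rightarrow>\<^sub>M M"
    and "quasi_invariant \<pi> M"
    and "\<nu> \<in> M \<rightarrow>\<^sub>M count_space UNIV"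
    and "invariant_ae \<pi> M \<nu>"
    and "cocycle \<pi> M \<nu> H U"
  shows "group_representation (direct_integral M \<nu> H) (cocycle_representation \<pi> M \<nu> H U)"
proof -
  have act_add: "\<pi> (g + h) x = \<pi> g (\<pi> h x)" and act_zero: "\<pi> 0 x = x" if "x \<in> space M" for g h x
    using assms(3,5) that by (simp_all add: group_action_def)
  have act_measurable: "\<pi> g \<in> M \<rightarrow>\<^sub>M M" for g
    using measurable_Pair2[OF assms(6), of g] by simp
  have "absolutely_continuous M (distr M M (\<pi> g))" for g
    unfolding absolutely_continuous_def
  proof
    fix E assume "E \<in> null_sets M"
    then have E: "E \<in> sets M" "emeasure M E = 0" by auto
    have "\<pi> (- g) ` E = \<pi> g -` E \<inter> space M"
    proof
      show "\<pi> (- g) ` E \<subseteq> \<pi> g -` E \<inter> space M"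
      proof (rule image_subsetI)
        fix x assume x: "x \<in> E"
        then have "x \<in> space M" using sets.sets_into_space[OF E(1)] by blast
        then show "\<pi> (- g) x \<in> \<pi> g -` E \<inter> space M"
          using x act_add[of x g "- g"] act_zero[of x] measurable_space[OF act_measurable] by simp
      qed
      show "\<pi> g -` E \<inter> space M \<subseteq> \<pi> (- g) ` E"
      proof
        fix x assume x: "x \<in> \<pi> g -` E \<inter> space M"
        then have "x = \<pi> (- g) (\<pi> g x)" using act_add[of x "- g" g] act_zero[of x] by simp
        then show "x \<in> \<pi> (- g) ` E" using x by blast
      qed
    qed
    moreover have "emeasure M (\<pi> (- g) ` E) = 0"
      using assms(7) E by (simp add: quasi_invariant_def)
    ultimately show "E \<in> null_sets (distr M M (\<pi> g))"
      using E by (simp add: null_sets_def emeasure_distr[OF act_measurable])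
  qed
  then interpret cocycle_bundle M \<pi> \<nu> H U
    using assms act_add act_zero
    by (intro cocycle_bundle.intro nonsingular_action.intro nonsingular_action_axioms.intro
        hilbert_bundle.intro cocycle_bundle_axioms.intro) simp_all
  show ?thesis by (rule group_representation_cocycle)
qed

end
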